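(* Let $TA$ be any timed automaton over $\Sigma$ and $\mathcal{A}$. Then for every TCTL formula $\phi$, $[\![\phi]\!]_{TA}=[\![\mathrm{emb}(\phi)]\!]_{TA}$.
   Context: Timed automata. Fix countably infinite disjoint sets $\mathbb{C}_A$ (automaton clocks) and $\mathbb{C}_F$ (freeze clocks), $\mathbb{C}=\mathbb{C}_A\cup\mathbb{C}_F$. Clock constraints: $g::=x\bowtie c\mid x-x'\bowtie c\mid g\wedge g$ with $c\in\mathbb{N}$, $\bowtie\in\{<,\le,>,\ge\}$; atomic ones (first two forms) form $\Phi_a(\mathbb{C})$. Valuations $v:\mathbb{C}\to\mathbb{R}_{\ge0}$ with $v+\delta$, $v[R:=0]$, $v[z:=\delta]$, $v\models g$ as usual. $\Sigma$ is a nonempty set of actions disjoint from $\mathbb{R}_{\ge0}$, $\mathcal{A}$ a set of atomic propositions disjoint from clock constraints. A timed automaton $TA=(L,L_0,CX,I,E,\mathcal{L})$: finite nonempty $L$, $\emptyset\ne L_0\subseteq L$, finite nonempty $CX\subseteq\mathbb{C}_A$, invariants $I(l)$ over $CX$, edges $E\subseteq L\times\Sigma\times\{\text{constraints over }CX\}\times2^{CX}\times L$, $\mathcal{L}:L\to2^{\mathcal{A}}$. Semantics: states $Q_{TA}=\{(l,v):v\models I(l)\}$; $(l,v)\xrightarrow{\delta}(l,v+\delta)$ iff $v+\delta'\models I(l)$ for $0\le\delta'\le\delta$; $(l,v)\xrightarrow{a}(l',v[R:=0])$ iff some $(l,a,g,R,l')\in E$ has $v\models g$ and $v[R:=0]\models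 I(l')$; labelling $\mathcal{L}_{TA}(l,v)=\mathcal{L}(l)\cup\{g\in\Phi_a(\mathbb{C}):v\models g\}$. $\delta(q)$ is the unique $q'$ with $q\xrightarrow{\delta}q'$ if it exists; $q[z:=0]$ resets $z$; $q\xrightarrow{K}q'$ means $q\xrightarrow{a}q'$ for some $a\in K$. Executions from $q$: finite or infinite sequences of consecutive transitions starting at $q$; duration = sum of delays; run = execution of infinite duration. Positions of an execution: initial state, target of each transition, and for each delay transition $q_1\xrightarrow{\delta}q_2$ with $\delta>0$ the states $\delta'(q_1)$, $0<\delta'<\delta$, ordered by occurrence. Until path from $Q_1$ to $Q_2$: some position's state is in $Q_2$ and all strictly earlier positions' states are in $Q_1$. TCTL: $\phi::=A\mid\neg\phi\mid\phi\vee\phi\mid\mathsf{A}(\phi\mathsf{U}\phi)\mid\mathsf{E}(\phi\mathsf{U}\phi)\mid z.\phi$, $A\in\mathcal{A}\cup\Phi_a(\mathbb{C})$, $z\in\mathbb{C}_F$; $[\![A]\!]_{TA}=\{q:A\in\mathcal{L}_{TA}(q)\}$, complement, union, $[\![\mathsf{E}(\phi_1\mathsf{U}\phi_2)]\!]_{TA}$ = states having some run that is an until path from $[\![\phi_1\vee\phi_2]\!]_{TA}$ to $[\![\phi_2]\!]_{TA}$, $\mathsf{A}$ likewise with every run, $[\![z.\phi]\!]_{TA}=\{q:q[z:=0]\in[\![\phi]\!]_{TA}\}$. $L^{rel}_{\mu,\nu}$: $\phi::=A\mid Y\mid\neg\phi\mid\phi\vee\phi\mid\langle K\rangle\phi\mid\exists_\phi\phi\mid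 z.\phi\mid\mu Y.\phi$ ($Y$ a propositional variable, $K\subseteq\Sigma$, $z\in\mathbb{C}_F$, free occurrences of $Y$ in $\mu Y.\phi$ under an even number of negations). For environment $\theta$: atoms via $\mathcal{L}_{TA}$, $[\![Y]\!]=\theta(Y)$, complement, union, $[\![\langle K\rangle\phi]\!]=\{q:\exists q'.\,q\xrightarrow{K}q'\in[\![\phi]\!]\}$, $[\![\exists_{\phi_1}\phi_2]\!]=\{q:\exists\delta.\ \delta(q)\in[\![\phi_2]\!]\wedge\forall\delta'<\delta.\ \delta'(q)\in[\![\phi_1\vee\phi_2]\!]\}$, $[\![z.\phi]\!]=\{q:q[z:=0]\in[\![\phi]\!]\}$, $[\![\mu Y.\phi]\!]_\theta=\bigcap\{S:[\![\phi]\!]_{\theta[Y:=S]}\subseteq S\}$. Closed formulas have $\theta$-independent semantics $[\![\phi]\!]_{TA}$. Abbreviations: $\wedge$, $\Rightarrow$; $[K]\phi=\neg\langle K\rangle\neg\phi$; $\nu Y.\phi=\neg\mu Y.\neg\phi[Y:=\neg Y]$; $\mathsf{tt}=(x\ge0)$, $\mathsf{ff}=(x<0)$; $\forall_{\phi_1}\phi_2=\neg\exists_{\neg\phi_1}\neg\phi_2$; $\exists\gamma=\exists_{\mathsf{tt}}\gamma$; $\forall\gamma=\forall_{\mathsf{ff}}\gamma$; with $z\in\mathbb{C}_F$, $\mathsf{TS}=z.(\forall\,z<1)$, $\mathrm{au}(\gamma_1,\gamma_2)=\exists_{\gamma_1}(\gamma_2\vee(\mathsf{TS}\wedge\forall\gamma_1))$,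 and $\mathsf{TDIV}=\nu X.z.(\mu Y.\exists((z\ge1\wedge X)\vee\langle\Sigma\rangle Y))$ for distinct variables $X,Y$. Translation $\mathrm{emb}$: $\mathrm{emb}(A)=A$; $\mathrm{emb}(\neg\phi)=\neg\mathrm{emb}(\phi)$; $\mathrm{emb}(\phi_1\vee\phi_2)=\mathrm{emb}(\phi_1)\vee\mathrm{emb}(\phi_2)$; $\mathrm{emb}(\mathsf{E}(\phi_1\mathsf{U}\phi_2))=\mu X.\exists_{\mathrm{emb}(\phi_1)}((\mathrm{emb}(\phi_2)\wedge\mathsf{TDIV})\vee(\mathrm{emb}(\phi_1)\wedge\langle\Sigma\rangle X))$; $\mathrm{emb}(\mathsf{A}(\phi_1\mathsf{U}\phi_2))=\mu X.z.\nu Y.\mathrm{au}(\mathsf{TDIV}\Rightarrow(\mathrm{emb}(\phi_1)\wedge(z\ge1\Rightarrow[\Sigma]X)\wedge(z<1\Rightarrow[\Sigma]Y)),\ \mathrm{emb}(\phi_2))$ where $z\in\mathbb{C}_F$ is a clock not occurring in $\phi_1,\phi_2$; $\mathrm{emb}(z.\phi)=z.\mathrm{emb}(\phi)$. *)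

theory Defs
  imports Complex_Main "HOL-Library.Extended_Nat" "HOL-Library.Extended_Nonnegative_Real"
begin

section \<open>Clocks and clock constraints\<close>

datatype clock = AClk nat | FClk nat

datatype cmp = Lt | Le | Gt | Ge

datatype atomic_constr = Cmp clock cmp nat | Diff clock clock cmp nat

datatype constr = Atomic atomic_constr | Conj constr constr

type_synonym valuation = "clock \<Rightarrow> real"

primrec cmp_sem :: "cmp \<Rightarrow> real \<Rightarrow> real \<Rightarrow> bool" where
  "cmp_sem Lt a b \<longleftrightarrow> a < b"
| "cmp_sem Le a b \<longleftrightarrow> a \<le> b"
| "cmp_sem Gt a b \<longleftrightarrow> a > b"
| "cmp_sem Ge a b \<longleftrightarrow> a \<ge> b"

primrec sat_atomic :: "valuation \<Rightarrow> atomic_constr \<Rightarrow> bool" where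
  "sat_atomic v (Cmp x r c) \<longleftrightarrow> cmp_sem r (v x) (real c)"
| "sat_atomic v (Diff x x' r c) \<longleftrightarrow> cmp_sem r (v x - v x') (real c)"

primrec sat :: "valuation \<Rightarrow> constr \<Rightarrow> bool" where
  "sat v (Atomic g) \<longleftrightarrow> sat_atomic v g"
| "sat v (Conj g h) \<longleftrightarrow> sat v g \<and> sat v h"

primrec atomic_clocks :: "atomic_constr \<Rightarrow> clock set" where
  "atomic_clocks (Cmp x r c) = {x}"
| "atomic_clocks (Diff x x' r c) = {x, x'}"

primrec constr_clocks :: "constr \<Rightarrow> clock set" where
  "constr_clocks (Atomic g) = atomic_clocks g"
| "constr_clocks (Conj g h) = constr_clocks g \<union> constr_clocks h"

definition val_add :: "valuation \<Rightarrow> real \<Rightarrow> valuation" where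
  "val_add v d = (\<lambda>x. v x + d)"

definition val_reset :: "valuation \<Rightarrow> clock set \<Rightarrow> valuation" where
  "val_reset v R = (\<lambda>x. if x \<in> R then 0 else v x)"


section \<open>Timed automata\<close>

text \<open>The set of actions is the universe of the type \<open>'a\<close>, the set of atomic propositions
  the universe of the type \<open>'p\<close>.\<close>

record ('l, 'a, 'p) ta =
  locs :: "'l set"
  inits :: "'l set"
  clks :: "clock set"
  invar :: "'l \<Rightarrow> constr"
  edges :: "('l \<times> 'a \<times> constr \<times> clock set \<times> 'l) set"
  props :: "'l \<Rightarrow> 'p set"

definition timed_automaton :: "('l, 'a, 'p) ta \<Rightarrow> bool" where
  "timed_automaton TA \<longleftrightarrow>
     finite (locs TA) \<and> locs TA \<noteq> {} \<and>
     inits TA \<noteq> {} \<and> inits TA \<subseteq> locs TA \<and>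
     finite (clks TA) \<and> clks TA \<noteq> {} \<and> clks TA \<subseteq> range AClk \<and>
     (\<forall>l\<in>locs TA. constr_clocks (invar TA l) \<subseteq> clks TA) \<and>
     edges TA \<subseteq> locs TA \<times> UNIV \<times> {g. constr_clocks g \<subseteq> clks TA} \<times> Pow (clks TA) \<times> locs TA"

type_synonym 'l state = "'l \<times> valuation"

definition states :: "('l, 'a, 'p) ta \<Rightarrow> 'l state set" where
  "states TA = {(l, v). l \<in> locs TA \<and> (\<forall>x. 0 \<le> v x) \<and> sat v (invar TA l)}"

datatype 'a lbl = Delay real | Act 'a

inductive step :: "('l, 'a, 'p) ta \<Rightarrow> 'l state \<Rightarrow> 'a lbl \<Rightarrow> 'l state \<Rightarrow> bool"
  for TA :: "('l, 'a, 'p) ta" where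
  delay: "(l, v) \<in> states TA \<Longrightarrow> 0 \<le> d \<Longrightarrow>
    (\<And>d'. 0 \<le> d' \<Longrightarrow> d' \<le> d \<Longrightarrow> sat (val_add v d') (invar TA l)) \<Longrightarrow>
    step TA (l, v) (Delay d) (l, val_add v d)"
| action: "(l, v) \<in> states TA \<Longrightarrow> (l, a, g, R, l') \<in> edges TA \<Longrightarrow> sat v g \<Longrightarrow>
    sat (val_reset v R) (invar TA l') \<Longrightarrow>
    step TA (l, v) (Act a) (l', val_reset v R)"

datatype 'p atom = Prop 'p | Constr atomic_constr

fun labelling :: "('l, 'a, 'p) ta \<Rightarrow> 'l state \<Rightarrow> 'p atom set" where
  "labelling TA (l, v) = Prop ` props TA l \<union> Constr ` {g. sat_atomic v g}"

fun state_reset :: "'l state \<Rightarrow> nat \<Rightarrow> 'l state" where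
  "state_reset (l, v) z = (l, v(FClk z := 0))"


section \<open>Executions, runs and until paths\<close>

text \<open>An execution with \<open>n = xlen r\<close> transitions (\<open>n\<close> may be infinite) is
  \<open>xst r 0\<close> --\<open>xlbl r 0\<close>--> \<open>xst r 1\<close> --\<open>xlbl r 1\<close>--> ...;
  the values of \<open>xst r\<close> beyond \<open>n\<close> and of \<open>xlbl r\<close> from \<open>n\<close> on are irrelevant.\<close>

record ('l, 'a) exec =
  xlen :: enat
  xst :: "nat \<Rightarrow> 'l state"
  xlbl :: "nat \<Rightarrow> 'a lbl"

definition execution :: "('l, 'a, 'p) ta \<Rightarrow> 'l state \<Rightarrow> ('l, 'a) exec \<Rightarrow> bool" where
  "execution TA q r \<longleftrightarrow> q \<in> states TA \<and> xst r 0 = q \<and>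
     (\<forall>i. enat i < xlen r \<longrightarrow> step TA (xst r i) (xlbl r i) (xst r (Suc i)))"

primrec lbl_delay :: "'a lbl \<Rightarrow> real" where
  "lbl_delay (Delay d) = d"
| "lbl_delay (Act a) = 0"

definition duration :: "('l, 'a) exec \<Rightarrow> ennreal" where
  "duration r = (\<Sum>i. if enat i < xlen r then ennreal (lbl_delay (xlbl r i)) else 0)"

definition run :: "('l, 'a, 'p) ta \<Rightarrow> 'l state \<Rightarrow> ('l, 'a) exec \<Rightarrow> bool" where
  "run TA q r \<longleftrightarrow> execution TA q r \<and> duration r = \<infinity>"

text \<open>The position \<open>(i, 0)\<close> is the initial state (\<open>i = 0\<close>) or the target of transition
  \<open>i - 1\<close>; the position \<open>(i, t)\<close> with \<open>t > 0\<close> lies strictly inside the delay transition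
  \<open>i\<close>, at time \<open>t\<close> after its source state. The order of occurrence is lexicographic.\<close>

definition positions :: "('l, 'a) exec \<Rightarrow> (nat \<times> real) set" where
  "positions r = {(i, 0) | i. enat i \<le> xlen r} \<union>
     {(i, t) | i t d. enat i < xlen r \<and> xlbl r i = Delay d \<and> 0 < t \<and> t < d}"

fun pos_less :: "nat \<times> real \<Rightarrow> nat \<times> real \<Rightarrow> bool" where
  "pos_less (i, t) (j, u) \<longleftrightarrow> i < j \<or> i = j \<and> t < u"

fun pos_state :: "('l, 'a) exec \<Rightarrow> nat \<times> real \<Rightarrow> 'l state" where
  "pos_state r (i, t) = (fst (xst r i), val_add (snd (xst r i)) t)"

definition until_path :: "('l, 'a) exec \<Rightarrow> 'l state set \<Rightarrow> 'l state set \<Rightarrow> bool" where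
  "until_path r Q1 Q2 \<longleftrightarrow> (\<exists>p\<in>positions r. pos_state r p \<in> Q2 \<and>
     (\<forall>p'\<in>positions r. pos_less p' p \<longrightarrow> pos_state r p' \<in> Q1))"


section \<open>TCTL\<close>

text \<open>Freeze quantifiers and freeze clocks are given by the index \<open>z\<close> of \<open>FClk z\<close>.\<close>

datatype 'p tctl =
    TAtom "'p atom"
  | TNot "'p tctl"
  | TOr "'p tctl" "'p tctl"
  | AU "'p tctl" "'p tctl"
  | EU "'p tctl" "'p tctl"
  | TFreeze nat "'p tctl"

primrec tctl_sem :: "('l, 'a, 'p) ta \<Rightarrow> 'p tctl \<Rightarrow> 'l state set" where
  "tctl_sem TA (TAtom A) = {q \<in> states TA. A \<in> labelling TA q}"
| "tctl_sem TA (TNot \<phi>) = states TA - tctl_sem TA \<phi>"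
| "tctl_sem TA (TOr \<phi>1 \<phi>2) = tctl_sem TA \<phi>1 \<union> tctl_sem TA \<phi>2"
| "tctl_sem TA (AU \<phi>1 \<phi>2) = {q \<in> states TA. \<forall>r. run TA q r \<longrightarrow>
     until_path r (tctl_sem TA \<phi>1 \<union> tctl_sem TA \<phi>2) (tctl_sem TA \<phi>2)}"
| "tctl_sem TA (EU \<phi>1 \<phi>2) = {q \<in> states TA. \<exists>r. run TA q r \<and>
     until_path r (tctl_sem TA \<phi>1 \<union> tctl_sem TA \<phi>2) (tctl_sem TA \<phi>2)}"
| "tctl_sem TA (TFreeze z \<phi>) = {q \<in> states TA. state_reset q z \<in> tctl_sem TA \<phi>}"

primrec atom_clocks :: "'p atom \<Rightarrow> clock set" where
  "atom_clocks (Prop P) = {}"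
| "atom_clocks (Constr g) = atomic_clocks g"

primrec tctl_clocks :: "'p tctl \<Rightarrow> clock set" where
  "tctl_clocks (TAtom A) = atom_clocks A"
| "tctl_clocks (TNot \<phi>) = tctl_clocks \<phi>"
| "tctl_clocks (TOr \<phi>1 \<phi>2) = tctl_clocks \<phi>1 \<union> tctl_clocks \<phi>2"
| "tctl_clocks (AU \<phi>1 \<phi>2) = tctl_clocks \<phi>1 \<union> tctl_clocks \<phi>2"
| "tctl_clocks (EU \<phi>1 \<phi>2) = tctl_clocks \<phi>1 \<union> tctl_clocks \<phi>2"
| "tctl_clocks (TFreeze z \<phi>) = insert (FClk z) (tctl_clocks \<phi>)"


section \<open>The relativized timed mu-calculus\<close>

datatype ('a, 'p) lrel =
    Atom "'p atom"
  | Var nat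
  | Neg "('a, 'p) lrel"
  | Or "('a, 'p) lrel" "('a, 'p) lrel"
  | Dia "'a set" "('a, 'p) lrel"
  | Ex "('a, 'p) lrel" "('a, 'p) lrel"
  | Freeze nat "('a, 'p) lrel"
  | Mu nat "('a, 'p) lrel"

text \<open>\<open>pol_vars True \<phi>\<close> and \<open>pol_vars False \<phi>\<close> are the variables with a free occurrence in
  \<open>\<phi>\<close> under an even and an odd number of negations, respectively.\<close>

primrec pol_vars :: "bool \<Rightarrow> ('a, 'p) lrel \<Rightarrow> nat set" where
  "pol_vars b (Atom A) = {}"
| "pol_vars b (Var Y) = (if b then {Y} else {})"
| "pol_vars b (Neg \<phi>) = pol_vars (\<not> b) \<phi>"
| "pol_vars b (Or \<phi>1 \<phi>2) = pol_vars b \<phi>1 \<union> pol_vars b \<phi>2"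
| "pol_vars b (Dia K \<phi>) = pol_vars b \<phi>"
| "pol_vars b (Ex \<phi>1 \<phi>2) = pol_vars b \<phi>1 \<union> pol_vars b \<phi>2"
| "pol_vars b (Freeze z \<phi>) = pol_vars b \<phi>"
| "pol_vars b (Mu Y \<phi>) = pol_vars b \<phi> - {Y}"

primrec wf_lrel :: "('a, 'p) lrel \<Rightarrow> bool" where
  "wf_lrel (Atom A) \<longleftrightarrow> True"
| "wf_lrel (Var Y) \<longleftrightarrow> True"
| "wf_lrel (Neg \<phi>) \<longleftrightarrow> wf_lrel \<phi>"
| "wf_lrel (Or \<phi>1 \<phi>2) \<longleftrightarrow> wf_lrel \<phi>1 \<and> wf_lrel \<phi>2"
| "wf_lrel (Dia K \<phi>) \<longleftrightarrow> wf_lrel \<phi>"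
| "wf_lrel (Ex \<phi>1 \<phi>2) \<longleftrightarrow> wf_lrel \<phi>1 \<and> wf_lrel \<phi>2"
| "wf_lrel (Freeze z \<phi>) \<longleftrightarrow> wf_lrel \<phi>"
| "wf_lrel (Mu Y \<phi>) \<longleftrightarrow> wf_lrel \<phi> \<and> Y \<notin> pol_vars False \<phi>"

definition closed_lrel :: "('a, 'p) lrel \<Rightarrow> bool" where
  "closed_lrel \<phi> \<longleftrightarrow> (\<forall>b. pol_vars b \<phi> = {})"

primrec lrel_env_sem ::
    "('l, 'a, 'p) ta \<Rightarrow> (nat \<Rightarrow> 'l state set) \<Rightarrow> ('a, 'p) lrel \<Rightarrow> 'l state set" where
  "lrel_env_sem TA \<theta> (Atom A) = {q \<in> states TA. A \<in> labelling TA q}"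
| "lrel_env_sem TA \<theta> (Var Y) = \<theta> Y"
| "lrel_env_sem TA \<theta> (Neg \<phi>) = states TA - lrel_env_sem TA \<theta> \<phi>"
| "lrel_env_sem TA \<theta> (Or \<phi>1 \<phi>2) = lrel_env_sem TA \<theta> \<phi>1 \<union> lrel_env_sem TA \<theta> \<phi>2"
| "lrel_env_sem TA \<theta> (Dia K \<phi>) =
     {q \<in> states TA. \<exists>a\<in>K. \<exists>q'. step TA q (Act a) q' \<and> q' \<in> lrel_env_sem TA \<theta> \<phi>}"
| "lrel_env_sem TA \<theta> (Ex \<phi>1 \<phi>2) =
     {q \<in> states TA. \<exists>d\<ge>0.
        (\<exists>q'. step TA q (Delay d) q' \<and> q' \<in> lrel_env_sem TA \<theta> \<phi>2) \<and>
        (\<forall>d'. 0 \<le> d' \<and> d' < d \<longrightarrow>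
           (\<exists>q'. step TA q (Delay d') q' \<and>
              q' \<in> lrel_env_sem TA \<theta> \<phi>1 \<union> lrel_env_sem TA \<theta> \<phi>2))}"
| "lrel_env_sem TA \<theta> (Freeze z \<phi>) =
     {q \<in> states TA. state_reset q z \<in> lrel_env_sem TA \<theta> \<phi>}"
| "lrel_env_sem TA \<theta> (Mu Y \<phi>) =
     \<Inter>{S. S \<subseteq> states TA \<and> lrel_env_sem TA (\<theta>(Y := S)) \<phi> \<subseteq> S}"

lemma lrel_env_sem_cong:
  "(\<And>b Y. Y \<in> pol_vars b \<phi> \<Longrightarrow> \<theta> Y = \<theta>' Y) \<Longrightarrow> lrel_env_sem TA \<theta> \<phi> = lrel_env_sem TA \<theta>' \<phi>"
proof (induction \<phi> arbitrary: \<theta> \<theta>')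
  case (Var Y)
  then show ?case by (auto split: if_splits)
next
  case (Neg \<phi>)
  have "lrel_env_sem TA \<theta> \<phi> = lrel_env_sem TA \<theta>' \<phi>"
  proof (rule Neg.IH)
    fix b Y assume "Y \<in> pol_vars b \<phi>"
    then show "\<theta> Y = \<theta>' Y" using Neg.prems[of Y "\<not> b"] by simp
  qed
  then show ?case by simp
next
  case (Or \<phi>1 \<phi>2)
  have "lrel_env_sem TA \<theta> \<phi>1 = lrel_env_sem TA \<theta>' \<phi>1"
    by (rule Or.IH(1), use Or.prems in auto)
  moreover have "lrel_env_sem TA \<theta> \<phi>2 = lrel_env_sem TA \<theta>' \<phi>2"
    by (rule Or.IH(2), use Or.prems in auto)
  ultimately show ?case by simp
next
  case (Ex \<phi>1 \<phi>2)
  have "lrel_env_sem TA \<theta> \<phi>1 = lrel_env_sem TA \<theta>' \<phi>1"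
    by (rule Ex.IH(1), use Ex.prems in auto)
  moreover have "lrel_env_sem TA \<theta> \<phi>2 = lrel_env_sem TA \<theta>' \<phi>2"
    by (rule Ex.IH(2), use Ex.prems in auto)
  ultimately show ?case by simp
next
  case (Dia K \<phi>)
  have "lrel_env_sem TA \<theta> \<phi> = lrel_env_sem TA \<theta>' \<phi>"
    by (rule Dia.IH, use Dia.prems in auto)
  then show ?case by simp
next
  case (Freeze z \<phi>)
  have "lrel_env_sem TA \<theta> \<phi> = lrel_env_sem TA \<theta>' \<phi>"
    by (rule Freeze.IH, use Freeze.prems in auto)
  then show ?case by simp
next
  case (Mu Y \<phi>)
  have "lrel_env_sem TA (\<theta>(Y := S)) \<phi> = lrel_env_sem TA (\<theta>'(Y := S)) \<phi>" for S
    by (rule Mu.IH, use Mu.prems in auto)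
  then show ?case by simp
qed simp

lemma closed_lrel_env_sem:
  "closed_lrel \<phi> \<Longrightarrow> lrel_env_sem TA \<theta> \<phi> = lrel_env_sem TA \<theta>' \<phi>"
  by (rule lrel_env_sem_cong) (simp add: closed_lrel_def)

text \<open>For closed formulas, the only ones to which it is applied, the following does not depend
  on the chosen environment (\<open>closed_lrel_env_sem\<close>).\<close>

definition lrel_sem :: "('l, 'a, 'p) ta \<Rightarrow> ('a, 'p) lrel \<Rightarrow> 'l state set" where
  "lrel_sem TA \<phi> = lrel_env_sem TA (\<lambda>_. {}) \<phi>"


section \<open>Derived operators\<close>

text \<open>\<open>neg_var Y \<phi>\<close> replaces the free occurrences of \<open>Y\<close> by \<open>\<not>Y\<close>; no capture can arise.\<close>

primrec neg_var :: "nat \<Rightarrow> ('a, 'p) lrel \<Rightarrow> ('a, 'p) lrel" where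
  "neg_var Y (Atom A) = Atom A"
| "neg_var Y (Var Z) = (if Z = Y then Neg (Var Z) else Var Z)"
| "neg_var Y (Neg \<phi>) = Neg (neg_var Y \<phi>)"
| "neg_var Y (Or \<phi>1 \<phi>2) = Or (neg_var Y \<phi>1) (neg_var Y \<phi>2)"
| "neg_var Y (Dia K \<phi>) = Dia K (neg_var Y \<phi>)"
| "neg_var Y (Ex \<phi>1 \<phi>2) = Ex (neg_var Y \<phi>1) (neg_var Y \<phi>2)"
| "neg_var Y (Freeze z \<phi>) = Freeze z (neg_var Y \<phi>)"
| "neg_var Y (Mu Z \<phi>) = Mu Z (if Z = Y then \<phi> else neg_var Y \<phi>)"

definition And :: "('a, 'p) lrel \<Rightarrow> ('a, 'p) lrel \<Rightarrow> ('a, 'p) lrel" where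
  "And \<phi>1 \<phi>2 = Neg (Or (Neg \<phi>1) (Neg \<phi>2))"

definition Imp :: "('a, 'p) lrel \<Rightarrow> ('a, 'p) lrel \<Rightarrow> ('a, 'p) lrel" where
  "Imp \<phi>1 \<phi>2 = Or (Neg \<phi>1) \<phi>2"

definition Box :: "'a set \<Rightarrow> ('a, 'p) lrel \<Rightarrow> ('a, 'p) lrel" where
  "Box K \<phi> = Neg (Dia K (Neg \<phi>))"

definition Nu :: "nat \<Rightarrow> ('a, 'p) lrel \<Rightarrow> ('a, 'p) lrel" where
  "Nu Y \<phi> = Neg (Mu Y (Neg (neg_var Y \<phi>)))"

definition cmp_atom :: "clock \<Rightarrow> cmp \<Rightarrow> nat \<Rightarrow> ('a, 'p) lrel" where
  "cmp_atom x r c = Atom (Constr (Cmp x r c))"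

definition TT :: "('a, 'p) lrel" where
  "TT = cmp_atom (AClk 0) Ge 0"

definition FF :: "('a, 'p) lrel" where
  "FF = cmp_atom (AClk 0) Lt 0"

definition All :: "('a, 'p) lrel \<Rightarrow> ('a, 'p) lrel \<Rightarrow> ('a, 'p) lrel" where
  "All \<phi>1 \<phi>2 = Neg (Ex (Neg \<phi>1) (Neg \<phi>2))"

definition TS :: "('a, 'p) lrel" where
  "TS = Freeze 0 (All FF (cmp_atom (FClk 0) Lt 1))"

definition au :: "('a, 'p) lrel \<Rightarrow> ('a, 'p) lrel \<Rightarrow> ('a, 'p) lrel" where
  "au \<gamma>1 \<gamma>2 = Ex \<gamma>1 (Or \<gamma>2 (And TS (All FF \<gamma>1)))"

definition TDIV :: "('a, 'p) lrel" where
  "TDIV = Nu 0 (Freeze 0 (Mu 1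
     (Ex TT (Or (And (cmp_atom (FClk 0) Ge 1) (Var 0)) (Dia UNIV (Var 1))))))"


section \<open>The translation\<close>

definition fresh_fclock :: "'p tctl \<Rightarrow> 'p tctl \<Rightarrow> nat" where
  "fresh_fclock \<phi>1 \<phi>2 = (SOME z. FClk z \<notin> tctl_clocks \<phi>1 \<union> tctl_clocks \<phi>2)"

primrec emb :: "'p tctl \<Rightarrow> ('a, 'p) lrel" where
  "emb (TAtom A) = Atom A"
| "emb (TNot \<phi>) = Neg (emb \<phi>)"
| "emb (TOr \<phi>1 \<phi>2) = Or (emb \<phi>1) (emb \<phi>2)"
| "emb (EU \<phi>1 \<phi>2) =
     Mu 0 (Ex (emb \<phi>1) (Or (And (emb \<phi>2) TDIV) (And (emb \<phi>1) (Dia UNIV (Var 0)))))"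
| "emb (AU \<phi>1 \<phi>2) = (let z = fresh_fclock \<phi>1 \<phi>2 in
     Mu 0 (Freeze z (Nu 1 (au
       (Imp TDIV
         (And (emb \<phi>1)
           (And (Imp (cmp_atom (FClk z) Ge 1) (Box UNIV (Var 0)))
                (Imp (cmp_atom (FClk z) Lt 1) (Box UNIV (Var 1))))))
       (emb \<phi>2)))))"
| "emb (TFreeze z \<phi>) = Freeze z (emb \<phi>)"

lemma finite_tctl_clocks: "finite (tctl_clocks \<phi>)"
proof (induction \<phi>)
  case (TAtom A)
  have "finite (atomic_clocks g)" for g by (cases g) auto
  then show ?case by (cases A) auto
qed auto

lemma fresh_fclock: "FClk (fresh_fclock \<phi>1 \<phi>2) \<notin> tctl_clocks \<phi>1 \<union> tctl_clocks \<phi>2"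
proof -
  have "infinite (range FClk)"
    by (simp add: finite_image_iff inj_on_def)
  then have "\<not> range FClk \<subseteq> tctl_clocks \<phi>1 \<union> tctl_clocks \<phi>2"
    using finite_tctl_clocks by (metis finite_Un finite_subset)
  then have "\<exists>z. FClk z \<notin> tctl_clocks \<phi>1 \<union> tctl_clocks \<phi>2" by blast
  then show ?thesis unfolding fresh_fclock_def by (rule someI_ex)
qed

lemma pol_vars_neg_var:
  "pol_vars b (neg_var Y \<phi>) = (pol_vars b \<phi> - {Y}) \<union> (pol_vars (\<not> b) \<phi> \<inter> {Y})"
  by (induction \<phi> arbitrary: b) auto

lemma wf_neg_var: "wf_lrel (neg_var Y \<phi>) = wf_lrel \<phi>"
  by (induction \<phi>) (auto simp: pol_vars_neg_var)

lemmas derived_defs = And_def Imp_def Box_def Nu_def cmp_atom_def TT_def FF_def All_def TS_def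
  au_def TDIV_def

lemma TDIV_wf_closed: "wf_lrel TDIV" "pol_vars b TDIV = {}"
  by (auto simp: derived_defs)

lemma emb_closed: "closed_lrel (emb \<phi> :: ('a, 'p) lrel)"
proof -
  have "\<forall>b. pol_vars b (emb \<phi> :: ('a, 'p) lrel) = {}"
    by (induction \<phi>)
       (auto simp: Let_def TDIV_wf_closed pol_vars_neg_var
          And_def Imp_def Box_def Nu_def cmp_atom_def FF_def All_def TS_def au_def)
  then show ?thesis by (simp add: closed_lrel_def)
qed

lemma emb_wf: "wf_lrel (emb \<phi> :: ('a, 'p) lrel)"
proof -
  have "pol_vars b (emb \<phi> :: ('a, 'p) lrel) = {}" for b and \<phi> :: "'p tctl"
    using emb_closed by (auto simp: closed_lrel_def)
  then show ?thesis
    by (induction \<phi>)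
       (auto simp: Let_def TDIV_wf_closed pol_vars_neg_var wf_neg_var
          And_def Imp_def Box_def Nu_def cmp_atom_def FF_def All_def TS_def au_def)
qed

end

theory Submission
  imports Defs
begin

text \<open>
  A state satisfies \<open>TDIV\<close> iff it has a run: the greatest fixpoint supplies finite paths of duration
  at least \<open>1\<close> that can be concatenated forever. Given this, \<open>EU\<close> is a least fixpoint over the
  transitions of the witnessing run.

  For \<open>AU\<close>, every run from a state of the fixpoint can be followed transition by transition: each time
  \<open>z\<close> exceeds \<open>1\<close> the outer least fixpoint is unfolded, and a run without actions cannot meet a
  time stop, so \<open>\<phi>2\<close> is reached. Conversely, if a state avoids a pre-fixed point \<open>S\<close>, then either a
  bad run starts there or a \<open>\<phi>2\<close>-avoiding path of duration at least \<open>1\<close> leads again outside \<open>S\<close>;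
  concatenating these paths yields a run that never meets \<open>\<phi>2\<close>.

  The last argument needs that the truth value of \<open>\<phi>2\<close> does not alternate infinitely often just
  after some point of a delay. Instead of regions, a symmetry is used: apply a strictly
  increasing bijection \<open>f\<close> of the real line with \<open>f (t + 1) = f t + 1\<close> to the current time and to
  all reset times. Constraints compare differences of such times with integers, so they are
  preserved, and runs are carried to runs. Suitable \<open>f\<close> fix all reset times and
  connect any two delays between which no relevant clock passes an integer.
\<close>

section \<open>Delays and transitions as relations on states\<close>

definition dly :: "'l state \<Rightarrow> real \<Rightarrow> 'l state" where
  "dly q t = (fst q, val_add (snd q) t)"

lemma dly_simps [simp]:
  "fst (dly q t) = fst q" "snd (dly q t) x = snd q x + t" "dly q 0 = q"
  "dly (dly q s) t = dly q (s + t)"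
  by (auto simp: dly_def val_add_def algebra_simps prod_eq_iff)

text \<open>\<open>dly\<close> is total, even for negative or forbidden delays, so that delays
  simply add up; admissibility is kept apart in this predicate. Asking for \<open>states TA\<close>
  throughout the delay makes splitting and joining delays a matter of intervals.\<close>

definition can_delay :: "('l, 'a, 'p) ta \<Rightarrow> 'l state \<Rightarrow> real \<Rightarrow> bool" where
  "can_delay TA q d \<longleftrightarrow> 0 \<le> d \<and> (\<forall>t. 0 \<le> t \<and> t \<le> d \<longrightarrow> dly q t \<in> states TA)"

lemma states_iff: "q \<in> states TA \<longleftrightarrow>
  fst q \<in> locs TA \<and> (\<forall>x. 0 \<le> snd q x) \<and> sat (snd q) (invar TA (fst q))"
  by (auto simp: states_def case_prod_beta)

lemma step_Delay_iff: "step TA q (Delay d) p \<longleftrightarrow> can_delay TA q d \<and> p = dly q d"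
proof
  assume "step TA q (Delay d) p"
  then show "can_delay TA q d \<and> p = dly q d"
    by cases (auto simp: can_delay_def states_iff dly_def val_add_def)
next
  assume a: "can_delay TA q d \<and> p = dly q d"
  obtain l v where q: "q = (l, v)" by (cases q)
  have "(l, v) \<in> states TA" "0 \<le> d"
    using a q unfolding can_delay_def by (metis dly_simps(3) order_refl)+
  moreover have "sat (val_add v d') (invar TA l)" if "0 \<le> d'" "d' \<le> d" for d'
    using a q that by (auto simp: can_delay_def states_iff dly_def)
  ultimately show "step TA q (Delay d) p"
    using a q by (auto simp: dly_def intro: step.delay)
qed

lemma step_Act_iff: "step TA q (Act a) p \<longleftrightarrow> q \<in> states TA \<and>
  (\<exists>g R. (fst q, a, g, R, fst p) \<in> edges TA \<and> sat (snd q) g \<and>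
     sat (snd p) (invar TA (fst p)) \<and> snd p = val_reset (snd q) R)"
proof
  assume "step TA q (Act a) p"
  then show "q \<in> states TA \<and> (\<exists>g R. (fst q, a, g, R, fst p) \<in> edges TA \<and> sat (snd q) g \<and>
     sat (snd p) (invar TA (fst p)) \<and> snd p = val_reset (snd q) R)"
    by cases auto
next
  assume "q \<in> states TA \<and> (\<exists>g R. (fst q, a, g, R, fst p) \<in> edges TA \<and> sat (snd q) g \<and>
     sat (snd p) (invar TA (fst p)) \<and> snd p = val_reset (snd q) R)"
  then show "step TA q (Act a) p"
    by (cases q; cases p) (auto intro: step.action)
qed

lemma can_delay_states: "can_delay TA q d \<Longrightarrow> q \<in> states TA"
  by (auto simp: can_delay_def dest: spec[of _ 0])

lemma can_delay_0 [simp]: "can_delay TA q 0 \<longleftrightarrow> q \<in> states TA"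
proof -
  have "0 \<le> t \<and> t \<le> 0 \<longleftrightarrow> t = 0" for t :: real by auto
  then show ?thesis by (simp add: can_delay_def)
qed

lemma can_delay_nonneg: "can_delay TA q d \<Longrightarrow> 0 \<le> d"
  by (simp add: can_delay_def)

lemma can_delay_le: "can_delay TA q d \<Longrightarrow> 0 \<le> e \<Longrightarrow> e \<le> d \<Longrightarrow> can_delay TA q e"
  by (auto simp: can_delay_def)

lemma can_delay_dly_states: "can_delay TA q d \<Longrightarrow> 0 \<le> e \<Longrightarrow> e \<le> d \<Longrightarrow> dly q e \<in> states TA"
  by (auto simp: can_delay_def)

lemma can_delay_add:
  assumes "can_delay TA q d" "can_delay TA (dly q d) e"
  shows "can_delay TA q (d + e)"
  unfolding can_delay_def
proof (intro conjI allI impI)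
  show "0 \<le> d + e" using assms by (simp add: can_delay_def)
  fix t assume t: "0 \<le> t \<and> t \<le> d + e"
  show "dly q t \<in> states TA"
  proof (cases "t \<le> d")
    case True then show ?thesis using assms t by (auto simp: can_delay_def)
  next
    case False
    then have "0 \<le> t - d \<and> t - d \<le> e" using t by simp
    then have "dly (dly q d) (t - d) \<in> states TA"
      using assms(2) unfolding can_delay_def by blast
    then show ?thesis by simp
  qed
qed

lemma can_delay_dly:
  assumes "can_delay TA q d" "0 \<le> e" "e \<le> d"
  shows "can_delay TA (dly q e) (d - e)"
  using assms by (auto simp: can_delay_def)

lemma states_nonneg: "q \<in> states TA \<Longrightarrow> 0 \<le> snd q x"
  by (simp add: states_iff)

lemma step_states: "step TA q l p \<Longrightarrow> q \<in> states TA"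
  by (cases l) (auto simp: step_Delay_iff step_Act_iff dest: can_delay_states)

lemma step_delay_nonneg: "step TA q l p \<Longrightarrow> 0 \<le> lbl_delay l"
  by (cases l) (auto simp: step_Delay_iff can_delay_def)

lemma step_can_delay: "step TA q l p \<Longrightarrow> can_delay TA q (lbl_delay l)"
  by (cases l) (auto simp: step_Delay_iff dest: step_states)

text \<open>The action rule checks the invariant of the target, not that it is a state. It is one
  because edges end in \<open>locs TA\<close> and resets keep clock values nonnegative.\<close>

lemma step_target_states:
  assumes "timed_automaton TA" "step TA q l p"
  shows "p \<in> states TA"
proof (cases l)
  case (Delay d)
  then show ?thesis using assms(2) by (auto simp: step_Delay_iff can_delay_def)
next
  case (Act a)
  then obtain g R where e: "(fst q, a, g, R, fst p) \<in> edges TA" "q \<in> states TA"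
      "sat (snd p) (invar TA (fst p))" "snd p = val_reset (snd q) R"
    using assms(2) by (auto simp: step_Act_iff)
  have "fst p \<in> locs TA" using e(1) assms(1) unfolding timed_automaton_def by blast
  then show ?thesis using e by (auto simp: states_iff val_reset_def)
qed

text \<open>Edges reset only clocks in \<open>clks TA\<close>, which are automaton clocks. Hence
  freeze clocks measure elapsed time from step to step.\<close>

lemma step_FClk:
  assumes "timed_automaton TA" "step TA q l p"
  shows "snd p (FClk z) = snd q (FClk z) + lbl_delay l"
proof (cases l)
  case (Delay d)
  then show ?thesis using assms(2) by (auto simp: step_Delay_iff)
next
  case (Act a)
  then obtain g R where e: "(fst q, a, g, R, fst p) \<in> edges TA" "snd p = val_reset (snd q) R"
    using assms(2) by (auto simp: step_Act_iff)
  have "R \<subseteq> range AClk" using e(1) assms(1) unfolding timed_automaton_def by blast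
  then show ?thesis using e Act by (auto simp: val_reset_def)
qed

section \<open>Runs as sequences of states and labels, and until paths along them\<close>

definition irun :: "('l, 'a, 'p) ta \<Rightarrow> (nat \<Rightarrow> 'l state) \<Rightarrow> (nat \<Rightarrow> 'a lbl) \<Rightarrow> bool" where
  "irun TA st lb \<longleftrightarrow> (\<forall>i. step TA (st i) (lb i) (st (Suc i))) \<and>
     (\<forall>B. \<exists>n. B \<le> (\<Sum>i<n. lbl_delay (lb i)))"

text \<open>Delays are closed intervals here, so the end of a delay is counted twice; for
  \<open>Q2 \<subseteq> Q1\<close> this is harmless, and it gives until paths a recursion on the first transition.\<close>

definition upath ::
    "(nat \<Rightarrow> 'l state) \<Rightarrow> (nat \<Rightarrow> 'a lbl) \<Rightarrow> 'l state set \<Rightarrow> 'l state set \<Rightarrow> bool" where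
  "upath st lb Q1 Q2 \<longleftrightarrow> (\<exists>n t. 0 \<le> t \<and> t \<le> lbl_delay (lb n) \<and> dly (st n) t \<in> Q2 \<and>
     (\<forall>u. 0 \<le> u \<and> u < t \<longrightarrow> dly (st n) u \<in> Q1) \<and>
     (\<forall>j<n. \<forall>u. 0 \<le> u \<and> u \<le> lbl_delay (lb j) \<longrightarrow> dly (st j) u \<in> Q1))"

lemma irun_step: "irun TA st lb \<Longrightarrow> step TA (st i) (lb i) (st (Suc i))"
  by (simp add: irun_def)

text \<open>Delays are nonnegative, so the series is the supremum of its partial sums. Stating
  divergence by unbounded real sums keeps extended reals out of the later arguments.\<close>

lemma duration_infinite_iff:
  assumes "xlen r = \<infinity>" and "\<And>i. 0 \<le> lbl_delay (xlbl r i)"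
  shows "duration r = \<infinity> \<longleftrightarrow> (\<forall>B. \<exists>n. B \<le> (\<Sum>i<n. lbl_delay (xlbl r i)))"
proof -
  let ?d = "\<lambda>i. lbl_delay (xlbl r i)"
  have eq: "duration r = (SUP n. ennreal (\<Sum>i<n. ?d i))"
    using assms by (simp add: duration_def suminf_eq_SUP sum_ennreal)
  show ?thesis
  proof
    assume "duration r = \<infinity>"
    then have "(SUP n. ennreal (\<Sum>i<n. ?d i)) = top" using eq by simp
    then have ex: "\<exists>n. ennreal \<bar>B\<bar> < ennreal (\<Sum>i<n. ?d i)" for B
      using SUP_eq_top_iff[of "\<lambda>n. ennreal (\<Sum>i<n. ?d i)" UNIV] by auto
    show "\<forall>B. \<exists>n. B \<le> (\<Sum>i<n. ?d i)"
    proof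
      fix B :: real
      obtain n where "ennreal \<bar>B\<bar> < ennreal (\<Sum>i<n. ?d i)" using ex by blast
      then show "\<exists>n. B \<le> (\<Sum>i<n. ?d i)" by (intro exI[of _ n]) (simp add: ennreal_less_iff)
    qed
  next
    assume a: "\<forall>B. \<exists>n. B \<le> (\<Sum>i<n. ?d i)"
    have "of_nat k \<le> duration r" for k
    proof -
      obtain n where "real k \<le> (\<Sum>i<n. ?d i)" using a by blast
      then have "of_nat k \<le> ennreal (\<Sum>i<n. ?d i)"
        by (metis ennreal_leI ennreal_of_nat_eq_real_of_nat)
      also have "\<dots> \<le> duration r" unfolding eq by (rule SUP_upper) simp
      finally show ?thesis .
    qed
    then show "duration r = \<infinity>"
      using ennreal_Ex_less_of_nat[of "duration r"] by (metis infinity_ennreal_def leD top.not_eq_extremum)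
  qed
qed

text \<open>Finitely many delays have a finite sum, so an execution of infinite duration has
  infinitely many transitions.\<close>

lemma run_iff: "run TA q r \<longleftrightarrow> xlen r = \<infinity> \<and> xst r 0 = q \<and> irun TA (xst r) (xlbl r)"
proof
  assume r: "run TA q r"
  have inf: "xlen r = \<infinity>"
  proof (rule ccontr)
    assume "xlen r \<noteq> \<infinity>"
    then obtain N where N: "xlen r = enat N" by auto
    have "duration r = (\<Sum>i<N. ennreal (lbl_delay (xlbl r i)))"
      unfolding duration_def N
      by (subst suminf_finite[of "{..<N}"]) auto
    also have "\<dots> < \<infinity>" by (simp add: less_top[symmetric])
    finally show False using r by (simp add: run_def)
  qed
  then have st: "\<And>i. step TA (xst r i) (xlbl r i) (xst r (Suc i))"
    using r by (simp add: run_def execution_def)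
  then show "xlen r = \<infinity> \<and> xst r 0 = q \<and> irun TA (xst r) (xlbl r)"
    using inf r duration_infinite_iff[OF inf step_delay_nonneg[OF st]]
    by (simp add: run_def execution_def irun_def)
next
  assume a: "xlen r = \<infinity> \<and> xst r 0 = q \<and> irun TA (xst r) (xlbl r)"
  then have st: "\<And>i. step TA (xst r i) (xlbl r i) (xst r (Suc i))"
    by (simp add: irun_def)
  then show "run TA q r"
    using a duration_infinite_iff[OF _ step_delay_nonneg[OF st]] step_states[OF st[of 0]]
    by (simp add: run_def execution_def irun_def)
qed

lemma pos_state_eq: "pos_state r (i, t) = dly (xst r i) t"
  by (simp add: dly_def)

text \<open>The end of a positive delay \<open>i\<close> and the position \<open>(Suc i, 0)\<close>
  carry the same state, so the two ways of counting positions differ only at these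
  endpoints.\<close>

lemma until_path_iff:
  assumes inf: "xlen r = \<infinity>" and run: "irun TA (xst r) (xlbl r)" and sub: "Q2 \<subseteq> Q1"
  shows "until_path r Q1 Q2 \<longleftrightarrow> upath (xst r) (xlbl r) Q1 Q2"
proof -
  let ?d = "\<lambda>i. lbl_delay (xlbl r i)"
  have pos: "(i, t) \<in> positions r \<longleftrightarrow> t = 0 \<or> 0 < t \<and> t < ?d i" for i t
    using inf by (cases "xlbl r i") (auto simp: positions_def)
  have nn: "0 \<le> ?d i" for i using step_delay_nonneg irun_step[OF run] by blast
  have last: "dly (xst r i) (?d i) = xst r (Suc i)" if "?d i \<noteq> 0" for i
    using irun_step[OF run, of i] that by (cases "xlbl r i") (auto simp: step_Delay_iff)
  show ?thesis
  proof
    assume "until_path r Q1 Q2"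
    then obtain i t where p: "(i, t) \<in> positions r" "dly (xst r i) t \<in> Q2"
      and e: "\<And>j u. (j, u) \<in> positions r \<Longrightarrow> pos_less (j, u) (i, t) \<Longrightarrow> dly (xst r j) u \<in> Q1"
      unfolding until_path_def by (metis pos_state_eq surj_pair)
    have t: "0 \<le> t" "t \<le> ?d i" using p(1) nn[of i] by (auto simp: pos)
    have "dly (xst r i) u \<in> Q1" if "0 \<le> u" "u < t" for u
      using e[of i u] that t by (cases "u = 0") (auto simp: pos)
    moreover have "dly (xst r j) u \<in> Q1" if "j < i" "0 \<le> u" "u \<le> ?d j" for j u
    proof (cases "u = ?d j \<and> u \<noteq> 0")
      case True
      then have eq: "dly (xst r j) u = xst r (Suc j)" using last by auto
      show ?thesis
      proof (cases "Suc j = i \<and> t = 0")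
        \<comment> \<open>The endpoint is the witness itself. As a position it is not earlier than
          the witness, so membership in \<open>Q1\<close> comes from
          \<open>Q2 \<subseteq> Q1\<close>.\<close>
        case True then show ?thesis using eq p(2) sub by auto
      next
        case False
        then have "pos_less (Suc j, 0) (i, t)" using that t by auto
        then show ?thesis using e[of "Suc j" 0] eq by (auto simp: pos)
      qed
    next
      case False
      then show ?thesis using that by (intro e) (auto simp: pos)
    qed
    ultimately show "upath (xst r) (xlbl r) Q1 Q2"
      unfolding upath_def using p(2) t by blast
  next
    assume "upath (xst r) (xlbl r) Q1 Q2"
    then obtain n t where t: "0 \<le> t" "t \<le> ?d n" "dly (xst r n) t \<in> Q2"
      and e1: "\<And>u. 0 \<le> u \<Longrightarrow> u < t \<Longrightarrow> dly (xst r n) u \<in> Q1"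
      and e2: "\<And>j u. j < n \<Longrightarrow> 0 \<le> u \<Longrightarrow> u \<le> ?d j \<Longrightarrow> dly (xst r j) u \<in> Q1"
      unfolding upath_def by blast
    have e: "dly (xst r j) u \<in> Q1" if "(j, u) \<in> positions r" "j < n \<or> j = n \<and> u < t" for j u
      using that e1[of u] e2[of j u] nn[of j] by (auto simp: pos)
    show "until_path r Q1 Q2"
    proof (cases "t = ?d n \<and> t \<noteq> 0")
      \<comment> \<open>A witness at the end of a positive delay is no position inside transition
        \<open>n\<close>; it is the position \<open>(Suc n, 0)\<close>.\<close>
      case True
      have "dly (xst r j) u \<in> Q1" if "(j, u) \<in> positions r" "pos_less (j, u) (Suc n, 0)" for j u
        using that True nn[of n] by (intro e) (auto simp: pos less_Suc_eq)
      moreover have "dly (xst r (Suc n)) 0 \<in> Q2" using True t last by auto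
      ultimately show ?thesis
        unfolding until_path_def
        by (intro bexI[of _ "(Suc n, 0)"]) (auto simp: pos pos_state_eq simp del: pos_state.simps)
    next
      case False
      then show ?thesis
        unfolding until_path_def using e t
        by (intro bexI[of _ "(n, t)"]) (auto simp: pos pos_state_eq simp del: pos_state.simps)
    qed
  qed
qed

lemma tctl_sem_AU: "tctl_sem TA (AU \<phi>1 \<phi>2) = {q \<in> states TA. \<forall>st lb. irun TA st lb \<and> st 0 = q \<longrightarrow>
     upath st lb (tctl_sem TA \<phi>1 \<union> tctl_sem TA \<phi>2) (tctl_sem TA \<phi>2)}"
  (is "_ = {q \<in> _. \<forall>st lb. _ \<longrightarrow> upath _ _ ?Q1 ?Q2}")
proof -
  have "(\<forall>r. run TA q r \<longrightarrow> until_path r ?Q1 ?Q2) \<longleftrightarrow>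
    (\<forall>st lb. irun TA st lb \<and> st 0 = q \<longrightarrow> upath st lb ?Q1 ?Q2)" for q
  proof safe
    fix st :: "nat \<Rightarrow> 'a state" and lb :: "nat \<Rightarrow> 'b lbl"
    assume "\<forall>r. run TA (st 0) r \<longrightarrow> until_path r ?Q1 ?Q2" "irun TA st lb"
    then show "upath st lb ?Q1 ?Q2"
      using until_path_iff[of "\<lparr>xlen = \<infinity>, xst = st, xlbl = lb\<rparr>" TA ?Q2 ?Q1]
      by (auto simp: run_iff)
  qed (auto simp: run_iff until_path_iff)
  then show ?thesis by simp
qed

lemma tctl_sem_EU: "tctl_sem TA (EU \<phi>1 \<phi>2) = {q. \<exists>st lb. irun TA st lb \<and> st 0 = q \<and>
     upath st lb (tctl_sem TA \<phi>1 \<union> tctl_sem TA \<phi>2) (tctl_sem TA \<phi>2)}"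
  (is "_ = {q. \<exists>st lb. _ \<and> _ \<and> upath _ _ ?Q1 ?Q2}")
proof -
  have "(q \<in> states TA \<and> (\<exists>r. run TA q r \<and> until_path r ?Q1 ?Q2)) \<longleftrightarrow>
    (\<exists>st lb. irun TA st lb \<and> st 0 = q \<and> upath st lb ?Q1 ?Q2)" for q
  proof safe
    fix r assume "run TA q r" "until_path r ?Q1 ?Q2"
    then show "\<exists>st lb. irun TA st lb \<and> st 0 = q \<and> upath st lb ?Q1 ?Q2"
      using until_path_iff[of r TA ?Q2 ?Q1] by (auto simp: run_iff)
  next
    fix st :: "nat \<Rightarrow> 'a state" and lb :: "nat \<Rightarrow> 'b lbl"
    assume a: "irun TA st lb" "upath st lb ?Q1 ?Q2"
    then show "\<exists>r. run TA (st 0) r \<and> until_path r ?Q1 ?Q2"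
      using until_path_iff[of "\<lparr>xlen = \<infinity>, xst = st, xlbl = lb\<rparr>" TA ?Q2 ?Q1]
      by (intro exI[of _ "\<lparr>xlen = \<infinity>, xst = st, xlbl = lb\<rparr>"]) (auto simp: run_iff)
    show "st 0 \<in> states TA" using step_states[OF irun_step[OF a(1)]] .
  qed
  then show ?thesis by simp
qed

lemma tctl_sem_states: "tctl_sem TA \<phi> \<subseteq> states TA"
  by (induction \<phi>) auto

section \<open>Divergent runs and finite paths\<close>

lemma irun_Cons:
  assumes "step TA q l (st 0)" "irun TA st lb"
  shows "irun TA (case_nat q st) (case_nat l lb)"
  unfolding irun_def
proof (intro conjI allI)
  fix i show "step TA (case_nat q st i) (case_nat l lb i) (case_nat q st (Suc i))"
    using assms by (cases i) (auto simp: irun_def)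
next
  fix B
  obtain n where "B - lbl_delay l \<le> (\<Sum>i<n. lbl_delay (lb i))"
    using assms(2) unfolding irun_def by blast
  then have "B \<le> (\<Sum>i<Suc n. lbl_delay (case_nat l lb i))"
    by (subst sum.lessThan_Suc_shift) simp
  then show "\<exists>n. B \<le> (\<Sum>i<n. lbl_delay (case_nat l lb i))" by blast
qed

lemma irun_tl:
  assumes "irun TA st lb"
  shows "irun TA (\<lambda>i. st (Suc i)) (\<lambda>i. lb (Suc i))"
  unfolding irun_def
proof (intro conjI allI)
  fix i show "step TA (st (Suc i)) (lb (Suc i)) (st (Suc (Suc i)))"
    using assms by (auto simp: irun_def)
next
  fix B
  \<comment> \<open>The absolute value and the summand \<open>1\<close> make the bound positive, so
    \<open>n\<close> cannot be \<open>0\<close> and a first transition can be split off.\<close>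
  obtain n where n: "\<bar>B\<bar> + lbl_delay (lb 0) + 1 \<le> (\<Sum>i<n. lbl_delay (lb i))"
    using assms unfolding irun_def by blast
  have "0 \<le> lbl_delay (lb 0)" using assms step_delay_nonneg unfolding irun_def by blast
  with n obtain m where "n = Suc m" by (cases n) auto
  then show "\<exists>n. B \<le> (\<Sum>i<n. lbl_delay (lb (Suc i)))"
    using n by (intro exI[of _ m]) (simp add: sum.lessThan_Suc_shift del: sum.lessThan_Suc)
qed

lemma upath_unfold:
  "upath st lb Q1 Q2 \<longleftrightarrow>
     (\<exists>t. 0 \<le> t \<and> t \<le> lbl_delay (lb 0) \<and> dly (st 0) t \<in> Q2 \<and>
        (\<forall>u. 0 \<le> u \<and> u < t \<longrightarrow> dly (st 0) u \<in> Q1)) \<or>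
     (\<forall>u. 0 \<le> u \<and> u \<le> lbl_delay (lb 0) \<longrightarrow> dly (st 0) u \<in> Q1) \<and>
        upath (\<lambda>i. st (Suc i)) (\<lambda>i. lb (Suc i)) Q1 Q2"
  (is "?L \<longleftrightarrow> ?A \<or> ?B")
proof
  assume ?L
  then obtain n t where t: "0 \<le> t" "t \<le> lbl_delay (lb n)" "dly (st n) t \<in> Q2"
    and e1: "\<forall>u. 0 \<le> u \<and> u < t \<longrightarrow> dly (st n) u \<in> Q1"
    and e2: "\<forall>j<n. \<forall>u. 0 \<le> u \<and> u \<le> lbl_delay (lb j) \<longrightarrow> dly (st j) u \<in> Q1"
    unfolding upath_def by blast
  show "?A \<or> ?B"
  proof (cases n)
    case 0
    then show ?thesis using t e1 by blast
  next
    case (Suc m)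
    have "\<forall>j<m. \<forall>u. 0 \<le> u \<and> u \<le> lbl_delay (lb (Suc j)) \<longrightarrow> dly (st (Suc j)) u \<in> Q1"
      using e2 Suc by auto
    then have "upath (\<lambda>i. st (Suc i)) (\<lambda>i. lb (Suc i)) Q1 Q2"
      unfolding upath_def using t e1 Suc by blast
    moreover have "\<forall>u. 0 \<le> u \<and> u \<le> lbl_delay (lb 0) \<longrightarrow> dly (st 0) u \<in> Q1"
      using e2 Suc by blast
    ultimately show ?thesis by blast
  qed
next
  assume "?A \<or> ?B"
  then show ?L
  proof
    assume ?A
    then show ?L unfolding upath_def by (metis not_less_zero)
  next
    assume b: ?B
    then obtain n t where t: "0 \<le> t" "t \<le> lbl_delay (lb (Suc n))" "dly (st (Suc n)) t \<in> Q2"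
      and e1: "\<forall>u. 0 \<le> u \<and> u < t \<longrightarrow> dly (st (Suc n)) u \<in> Q1"
      and e2: "\<forall>j<n. \<forall>u. 0 \<le> u \<and> u \<le> lbl_delay (lb (Suc j)) \<longrightarrow> dly (st (Suc j)) u \<in> Q1"
      unfolding upath_def by blast
    have "\<forall>j<Suc n. \<forall>u. 0 \<le> u \<and> u \<le> lbl_delay (lb j) \<longrightarrow> dly (st j) u \<in> Q1"
      using b e2 by (auto simp: less_Suc_eq_0_disj)
    then show ?L unfolding upath_def using t e1 by blast
  qed
qed

section \<open>Divergent states and counterexamples to until\<close>

definition divg :: "('l, 'a, 'p) ta \<Rightarrow> 'l state set" where
  "divg TA = {q. \<exists>st lb. irun TA st lb \<and> st 0 = q}"

text \<open>The semantics of \<open>AU\<close> is a complement of such a set, so both inclusions can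
  be argued by transporting a single violating run.\<close>

definition bad :: "('l, 'a, 'p) ta \<Rightarrow> 'l state set \<Rightarrow> 'l state set \<Rightarrow> 'l state set" where
  "bad TA Q1 Q2 = {q. \<exists>st lb. irun TA st lb \<and> st 0 = q \<and> \<not> upath st lb Q1 Q2}"

lemma divg_states: "divg TA \<subseteq> states TA"
  by (auto simp: divg_def) (metis irun_step step_states)

lemma divg_step:
  assumes "step TA q l p" "p \<in> divg TA"
  shows "q \<in> divg TA"
proof -
  obtain st lb where "irun TA st lb" "st 0 = p" using assms(2) by (auto simp: divg_def)
  then have "irun TA (case_nat q st) (case_nat l lb)" using assms(1) by (intro irun_Cons) auto
  then show ?thesis unfolding divg_def by force
qed

text \<open>A run can be started in the middle of its first delay by splitting that delay. Applied
  to tails, this makes \<open>TDIV\<close> true wherever a run passes, so conditions that assume or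
  demand \<open>TDIV\<close> take effect there.\<close>

lemma irun_divg:
  assumes r: "irun TA st lb" and u: "0 \<le> u" "u \<le> lbl_delay (lb 0)"
  shows "dly (st 0) u \<in> divg TA"
proof -
  have s: "step TA (st 0) (lb 0) (st 1)" using irun_step[OF r, of 0] by simp
  have 1: "st 1 \<in> divg TA" using irun_tl[OF r] unfolding divg_def by fastforce
  show ?thesis
  proof (cases "lb 0")
    case (Delay d)
    have "step TA (dly (st 0) u) (Delay (d - u)) (st 1)"
      using s u Delay by (auto simp: step_Delay_iff intro: can_delay_dly)
    then show ?thesis using 1 divg_step by blast
  next
    case (Act a)
    then have "u = 0" using u by simp
    then show ?thesis using divg_step[OF s 1] by simp
  qed
qed

lemma bad_step:
  assumes "step TA q l p" "p \<in> bad TA Q1 Q2"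
    and "\<And>u. 0 \<le> u \<Longrightarrow> u \<le> lbl_delay l \<Longrightarrow> dly q u \<notin> Q2"
  shows "q \<in> bad TA Q1 Q2"
proof -
  obtain st lb where r: "irun TA st lb" "st 0 = p" "\<not> upath st lb Q1 Q2"
    using assms(2) by (auto simp: bad_def)
  then have "irun TA (case_nat q st) (case_nat l lb)" using assms(1) by (intro irun_Cons) auto
  moreover have "\<not> upath (case_nat q st) (case_nat l lb) Q1 Q2"
    using r(3) assms(3) by (subst upath_unfold) auto
  ultimately show ?thesis unfolding bad_def by force
qed

text \<open>An initial state outside both sets already refutes the until; divergence provides the
  run to be refuted.\<close>

lemma bad_blocked:
  assumes "q \<in> divg TA" "q \<notin> Q1" "q \<notin> Q2"
  shows "q \<in> bad TA Q1 Q2"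
proof -
  obtain st lb where r: "irun TA st lb" "st 0 = q" using assms(1) by (auto simp: divg_def)
  have "\<not> upath st lb Q1 Q2"
  proof (subst upath_unfold, safe)
    fix t assume t: "0 \<le> t" "dly (st 0) t \<in> Q2" and e: "\<forall>u. 0 \<le> u \<and> u < t \<longrightarrow> dly (st 0) u \<in> Q1"
    show False using t e[rule_format, of 0] assms r by (cases "t = 0") auto
  next
    assume e: "\<forall>u. 0 \<le> u \<and> u \<le> lbl_delay (lb 0) \<longrightarrow> dly (st 0) u \<in> Q1"
    show False using e[rule_format, of 0] assms r step_delay_nonneg[OF irun_step[OF r(1)]] by auto
  qed
  then show ?thesis using r unfolding bad_def by blast
qed

lemma bad_avoid:
  assumes "irun TA st lb" "\<And>i u. 0 \<le> u \<Longrightarrow> u \<le> lbl_delay (lb i) \<Longrightarrow> dly (st i) u \<notin> Q2"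
  shows "st 0 \<in> bad TA Q1 Q2"
  using assms unfolding bad_def upath_def by blast

lemma tctl_sem_AU_bad:
  "tctl_sem TA (AU \<phi>1 \<phi>2) = states TA - bad TA (tctl_sem TA \<phi>1 \<union> tctl_sem TA \<phi>2) (tctl_sem TA \<phi>2)"
  unfolding tctl_sem_AU bad_def by blast

section \<open>Finite paths and their concatenation\<close>

inductive path :: "('l, 'a, 'p) ta \<Rightarrow> 'l state set \<Rightarrow> nat \<Rightarrow> 'l state \<Rightarrow> real \<Rightarrow> 'l state \<Rightarrow> bool"
  for TA A where
  path_nil: "path TA A 0 q 0 q"
| path_step: "step TA q l p \<Longrightarrow> (\<And>u. 0 \<le> u \<Longrightarrow> u \<le> lbl_delay l \<Longrightarrow> dly q u \<in> A) \<Longrightarrow>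
    path TA A n p D p' \<Longrightarrow> path TA A (Suc n) q (lbl_delay l + D) p'"

text \<open>Transitions inside \<open>A\<close> meet no state of \<open>Q2\<close>, so prepending
  them to a violating run leaves it violating.\<close>

lemma bad_path: "path TA A n q D p \<Longrightarrow> A \<inter> Q2 = {} \<Longrightarrow> p \<in> bad TA Q1 Q2 \<Longrightarrow> q \<in> bad TA Q1 Q2"
  by (induction rule: path.induct) (auto intro: bad_step)

text \<open>A configuration \<open>(q, E, k, n)\<close> records the current state, the elapsed time, and that an
  \<open>n\<close>-step path from \<open>q\<close> into \<open>X\<close> brings the elapsed time to at least \<open>k\<close>. Each time \<open>n\<close> reaches
  \<open>0\<close>, the counter \<open>k\<close> is increased.\<close>

lemma irun_of_paths:
  fixes TA :: "('l, 'a, 'p) ta"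
  assumes X: "\<And>q. q \<in> X \<Longrightarrow> \<exists>n D p. 1 \<le> D \<and> path TA A n q D p \<and> p \<in> X" and q0: "q0 \<in> X"
  obtains st :: "nat \<Rightarrow> 'l state" and lb :: "nat \<Rightarrow> 'a lbl" where "irun TA st lb" "st 0 = q0"
    "\<And>i u. 0 \<le> u \<Longrightarrow> u \<le> lbl_delay (lb i) \<Longrightarrow> dly (st i) u \<in> A"
proof -
  \<comment> \<open>The conjunct \<open>real k \<le> E + 1\<close> yields divergence: the target
    \<open>k\<close> is never more than \<open>1\<close> ahead of the elapsed time, and
    \<open>k\<close> will be unbounded.\<close>
  define inv where "inv = (\<lambda>(q, E, k, n). real k \<le> E + 1 \<and>
    (\<exists>D p. path TA A n q D p \<and> real k \<le> E + D \<and> p \<in> X))"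
  define nxt where "nxt = (\<lambda>(q, E, k, n) (l :: 'a lbl) (q', E', k', n'). step TA q l q' \<and>
    (\<forall>u. 0 \<le> u \<and> u \<le> lbl_delay l \<longrightarrow> dly q u \<in> A) \<and> E' = E + lbl_delay l \<and>
    (if n = 0 then k' = Suc k else k' = k \<and> n = Suc n'))"
  have first: "\<exists>l q' n'. n = Suc n' \<and> step TA q l q' \<and>
      (\<forall>u. 0 \<le> u \<and> u \<le> lbl_delay l \<longrightarrow> dly q u \<in> A) \<and> path TA A n' q' (D - lbl_delay l) p"
    if "path TA A n q D p" "n \<noteq> 0" for n q D p
    using that
  proof cases
    case (path_step l q' m D')
    then show ?thesis by (intro exI[of _ l] exI[of _ q'] exI[of _ m]) auto
  qed simp
  have ex: "\<exists>c' l. inv c' \<and> nxt c l c'" if i: "inv c" for c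
  proof -
    obtain q E k n where c: "c = (q, E, k, n)" by (cases c)
    obtain D p where p: "path TA A n q D p" "real k \<le> E + D" "p \<in> X" "real k \<le> E + 1"
      using i c by (auto simp: inv_def)
    show ?thesis
    proof (cases "n = 0")
      case False
      then obtain l q' n' where f: "n = Suc n'" "step TA q l q'"
        "\<forall>u. 0 \<le> u \<and> u \<le> lbl_delay l \<longrightarrow> dly q u \<in> A" "path TA A n' q' (D - lbl_delay l) p"
        using first[OF p(1)] by blast
      have "inv (q', E + lbl_delay l, k, n')"
        using f(4) p step_delay_nonneg[OF f(2)] unfolding inv_def
        by (auto simp del: split_paired_Ex intro!: exI[of _ "D - lbl_delay l"] exI[of _ p])
      moreover have "nxt c l (q', E + lbl_delay l, k, n')" using f c by (auto simp: nxt_def)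
      ultimately show ?thesis by blast
    next
      \<comment> \<open>The target \<open>k\<close> is reached, so \<open>real k \<le> E\<close> and
        the next target \<open>Suc k\<close> respects the bound. The new path has duration at least
        \<open>1\<close>, hence it is not empty and reaches that target.\<close>
      case True
      then have "q = p" "D = 0" using p(1) by (auto elim: path.cases)
      then have "q \<in> X" "real k \<le> E" using p by auto
      then obtain n1 D1 p1 where p1: "1 \<le> D1" "path TA A n1 q D1 p1" "p1 \<in> X" using X by blast
      then have "n1 \<noteq> 0" by (auto elim: path.cases)
      then obtain l q' n' where f: "n1 = Suc n'" "step TA q l q'"
        "\<forall>u. 0 \<le> u \<and> u \<le> lbl_delay l \<longrightarrow> dly q u \<in> A" "path TA A n' q' (D1 - lbl_delay l) p1"
        using first[OF p1(2)] by blast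
      have "inv (q', E + lbl_delay l, Suc k, n')"
        using f(4) p1 \<open>real k \<le> E\<close> step_delay_nonneg[OF f(2)] unfolding inv_def
        by (auto simp del: split_paired_Ex intro!: exI[of _ "D1 - lbl_delay l"] exI[of _ p1])
      moreover have "nxt c l (q', E + lbl_delay l, Suc k, n')" using f c True by (auto simp: nxt_def)
      ultimately show ?thesis by blast
    qed
  qed
  have "inv (q0, 0, 0, 0)" using q0 path_nil[of TA A q0] unfolding inv_def by fastforce
  then obtain cs where cs: "cs 0 = (q0, 0, 0, 0)" "\<And>i. inv (cs i)" "\<And>i. \<exists>l. nxt (cs i) l (cs (Suc i))"
    using dependent_nat_choice[of "\<lambda>i c. inv c \<and> (i = 0 \<longrightarrow> c = (q0, 0, 0, 0))"
        "\<lambda>i c c'. \<exists>l. nxt c l c'"] ex by (metis Zero_not_Suc)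
  obtain lb where lb: "\<And>i. nxt (cs i) (lb i) (cs (Suc i))" using cs(3) by metis
  define st where "st = (\<lambda>i. fst (cs i))"
  define E where "E = (\<lambda>i. fst (snd (cs i)))"
  define k where "k = (\<lambda>i. fst (snd (snd (cs i))))"
  define n where "n = (\<lambda>i. snd (snd (snd (cs i))))"
  have nx: "step TA (st i) (lb i) (st (Suc i))"
    "0 \<le> u \<Longrightarrow> u \<le> lbl_delay (lb i) \<Longrightarrow> dly (st i) u \<in> A"
    "E (Suc i) = E i + lbl_delay (lb i)"
    "n i = 0 \<Longrightarrow> k (Suc i) = Suc (k i)" "n i \<noteq> 0 \<Longrightarrow> k (Suc i) = k i \<and> n i = Suc (n (Suc i))" for i u
    using lb[of i] by (auto simp: nxt_def st_def E_def k_def n_def case_prod_beta split: if_splits)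
  have E: "E i = (\<Sum>j<i. lbl_delay (lb j))" for i
    by (induction i) (use cs(1) nx(3) in \<open>auto simp: E_def\<close>)
  have kE: "real (k i) \<le> E i + 1" for i
    using cs(2)[of i] by (auto simp: inv_def k_def E_def case_prod_beta)
  have inc: "\<exists>j. k j = Suc (k i)" if "n i = m" for i m
    using that
  proof (induction m arbitrary: i)
    case 0 then show ?case using nx(4) by blast
  next
    case (Suc m)
    then have "k (Suc i) = k i" "n (Suc i) = m" using nx(5)[of i] by auto
    then show ?case using Suc.IH[of "Suc i"] by auto
  qed
  have unb: "\<exists>i. k i = m" for m
  proof (induction m)
    case 0 then show ?case using cs(1) by (intro exI[of _ 0]) (simp add: k_def)
  next
    case (Suc m) then show ?case using inc by blast
  qed
  have "irun TA st lb"
    unfolding irun_def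
  proof (intro conjI allI nx(1))
    fix B :: real
    obtain m :: nat where "B + 1 \<le> real m" using real_arch_simple by blast
    moreover obtain i where "k i = m" using unb by blast
    ultimately have "B \<le> (\<Sum>j<i. lbl_delay (lb j))" using kE[of i] E[of i] by auto
    then show "\<exists>n. B \<le> (\<Sum>j<n. lbl_delay (lb j))" by blast
  qed
  moreover have "st 0 = q0" using cs(1) by (simp add: st_def)
  ultimately show ?thesis using that nx(2) by blast
qed

section \<open>Time warps\<close>

declare split_paired_All [simp del] split_paired_Ex [simp del]

text \<open>These are the lifts of orientation-preserving homeomorphisms of the circle: monotonicity
  and surjectivity together give continuity. Closure under inverses makes the symmetry usable in
  both directions.\<close>

definition warp_fun :: "(real \<Rightarrow> real) \<Rightarrow> bool" where
  "warp_fun f \<longleftrightarrow> strict_mono f \<and> surj f \<and> (\<forall>t. f (t + 1) = f t + 1)"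

lemma warp_fun_mono: "warp_fun f \<Longrightarrow> f s < f t \<longleftrightarrow> s < t" "warp_fun f \<Longrightarrow> f s \<le> f t \<longleftrightarrow> s \<le> t"
  by (simp_all add: warp_fun_def strict_mono_less strict_mono_less_eq)

lemma warp_fun_add: "warp_fun f \<Longrightarrow> f (t + real c) = f t + real c"
  by (induction c) (auto simp: warp_fun_def add.assoc[symmetric] add.commute[of 1])

lemma warp_fun_inv_apply: "warp_fun f \<Longrightarrow> inv f (f t) = t" "warp_fun f \<Longrightarrow> f (inv f t) = t"
  by (simp_all add: warp_fun_def strict_mono_imp_inj_on surj_f_inv_f)

lemma warp_fun_inv_inv: "warp_fun f \<Longrightarrow> inv (inv f) = f"
  by (simp add: warp_fun_def strict_mono_imp_inj_on bij_def inv_inv_eq)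

lemma warp_fun_inv:
  assumes "warp_fun f" shows "warp_fun (inv f)"
  unfolding warp_fun_def
proof (intro conjI allI)
  show "strict_mono (inv f)"
    using warp_fun_mono(1)[OF assms] warp_fun_inv_apply(2)[OF assms] by (metis strict_mono_def)
  show "surj (inv f)" using warp_fun_inv_apply(1)[OF assms] by (metis surjI)
  fix t
  have "f (inv f t + 1) = t + 1"
    using assms warp_fun_inv_apply(2)[OF assms, of t] by (simp add: warp_fun_def)
  then show "inv f (t + 1) = inv f t + 1" using warp_fun_inv_apply(1)[OF assms] by metis
qed

lemma warp_fun_id: "warp_fun (\<lambda>t. t)"
  by (simp add: warp_fun_def strict_mono_def)

text \<open>Comparing \<open>a - b\<close> with \<open>c\<close> is comparing \<open>a\<close> with
  \<open>b + c\<close>, and \<open>f\<close> preserves order and commutes with adding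
  \<open>c\<close>.\<close>

lemma warp_fun_cmp:
  assumes "warp_fun f"
  shows "cmp_sem r (f a - f b) (real c) \<longleftrightarrow> cmp_sem r (a - b) (real c)"
proof -
  have f: "f b + real c = f (b + real c)" using warp_fun_add[OF assms] by simp
  have "f a - f b < real c \<longleftrightarrow> f a < f (b + real c)" "f a - f b \<le> real c \<longleftrightarrow> f a \<le> f (b + real c)"
    "f a - f b > real c \<longleftrightarrow> f a > f (b + real c)" "f a - f b \<ge> real c \<longleftrightarrow> f a \<ge> f (b + real c)"
    unfolding f[symmetric] by auto
  then show ?thesis by (cases r) (auto simp: warp_fun_mono[OF assms])
qed

text \<open>At time \<open>\<tau>\<close> the clock \<open>x\<close> was last reset at time \<open>\<tau> - snd q x\<close>; \<open>f\<close> is applied to both times.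
  Clocks outside \<open>C\<close> are unconstrained.\<close>

definition warped ::
    "(real \<Rightarrow> real) \<Rightarrow> real \<Rightarrow> clock set \<Rightarrow> 'l state \<Rightarrow> 'l state \<Rightarrow> bool" where
  "warped f \<tau> C q q' \<longleftrightarrow> fst q' = fst q \<and> (\<forall>x\<in>C. snd q' x = f \<tau> - f (\<tau> - snd q x))"

text \<open>The inverse warp acts at the time \<open>f \<tau>\<close> of the image. Thus one
  implication, shown for every warp, yields an equivalence.\<close>

lemma warped_sym:
  assumes "warp_fun f" "warped f \<tau> C q q'"
  shows "warped (inv f) (f \<tau>) C q' q"
  using assms(2) by (auto simp: warped_def warp_fun_inv_apply[OF assms(1)])

lemma warped_sat_atomic:
  assumes "warp_fun f" "warped f \<tau> C q q'" "atomic_clocks g \<subseteq> C"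
  shows "sat_atomic (snd q') g \<longleftrightarrow> sat_atomic (snd q) g"
proof (cases g)
  case (Cmp x r c)
  then show ?thesis
    using assms warp_fun_cmp[OF assms(1), of r \<tau> "\<tau> - snd q x" c] by (auto simp: warped_def)
next
  case (Diff x y r c)
  \<comment> \<open>The current time cancels: \<open>x - y\<close> is the reset time of
    \<open>y\<close> minus that of \<open>x\<close>, hence the swapped order.\<close>
  then show ?thesis
    using assms warp_fun_cmp[OF assms(1), of r "\<tau> - snd q y" "\<tau> - snd q x" c]
    by (auto simp: warped_def)
qed

lemma warped_sat:
  assumes "warp_fun f" "warped f \<tau> C q q'" "constr_clocks g \<subseteq> C"
  shows "sat (snd q') g \<longleftrightarrow> sat (snd q) g"
  using assms(3) by (induction g) (auto simp: warped_sat_atomic[OF assms(1,2)])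

lemma warped_dly:
  "warped f \<tau> C q q' \<Longrightarrow> warped f (\<tau> + t) C (dly q t) (dly q' (f (\<tau> + t) - f \<tau>))"
  by (auto simp: warped_def)

text \<open>The relation leaves clocks outside \<open>C\<close> free in \<open>q'\<close>, so
  nonnegativity has to be supplied separately.\<close>

lemma warped_states:
  assumes "timed_automaton TA" "clks TA \<subseteq> C" "warp_fun f" "warped f \<tau> C q q'"
    "q \<in> states TA" "\<And>x. 0 \<le> snd q' x"
  shows "q' \<in> states TA"
proof -
  have "fst q' = fst q" using assms(4) by (simp add: warped_def)
  moreover have "fst q \<in> locs TA" using assms(5) by (simp add: states_iff)
  moreover from this have "constr_clocks (invar TA (fst q)) \<subseteq> C"
    using assms(1,2) unfolding timed_automaton_def by blast
  ultimately show ?thesis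
    using warped_sat[OF assms(3,4)] assms(5,6) by (simp add: states_iff)
qed

lemma warped_can_delay:
  assumes "timed_automaton TA" "clks TA \<subseteq> C" and f: "warp_fun f" and w: "warped f \<tau> C q q'"
    and d: "can_delay TA q d" and q': "q' \<in> states TA"
  shows "can_delay TA q' (f (\<tau> + d) - f \<tau>)"
  unfolding can_delay_def
proof (intro conjI allI impI)
  show "0 \<le> f (\<tau> + d) - f \<tau>" using can_delay_nonneg[OF d] warp_fun_mono[OF f] by simp
  fix u assume u: "0 \<le> u \<and> u \<le> f (\<tau> + d) - f \<tau>"
  \<comment> \<open>The delay on the source side that corresponds to \<open>u\<close>; monotonicity
    of \<open>f\<close> puts it between \<open>0\<close> and \<open>d\<close>.\<close>
  define t where "t = inv f (f \<tau> + u) - \<tau>"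
  have ft: "f (\<tau> + t) = f \<tau> + u" by (simp add: t_def warp_fun_inv_apply[OF f])
  then have "f \<tau> \<le> f (\<tau> + t)" "f (\<tau> + t) \<le> f (\<tau> + d)" using u by auto
  then have t: "0 \<le> t" "t \<le> d" by (simp_all add: warp_fun_mono[OF f])
  have "warped f (\<tau> + t) C (dly q t) (dly q' u)" using warped_dly[OF w, of t] ft by simp
  moreover have "dly q t \<in> states TA" using can_delay_dly_states[OF d] t by blast
  moreover have "0 \<le> snd (dly q' u) x" for x using states_nonneg[OF q', of x] u by simp
  ultimately show "dly q' u \<in> states TA" using warped_states[OF assms(1,2) f] by blast
qed

text \<open>A clock reset by an action has reset time \<open>\<tau>\<close>, and
  \<open>f \<tau> - f \<tau>\<close> is \<open>0\<close> on the other side as well. The clause for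
  the identity warp keeps the label, which later preserves length and duration of paths.\<close>

lemma warped_step:
  assumes ta: "timed_automaton TA" "clks TA \<subseteq> C" and f: "warp_fun f" and w: "warped f \<tau> C q q'"
    and s: "step TA q l p" and q': "q' \<in> states TA"
  shows "\<exists>l' p'. step TA q' l' p' \<and> lbl_delay l' = f (\<tau> + lbl_delay l) - f \<tau> \<and>
    (f = (\<lambda>t. t) \<longrightarrow> l' = l) \<and> warped f (\<tau> + lbl_delay l) C p p'"
proof (cases l)
  case (Delay d)
  then have c: "can_delay TA q d" "p = dly q d" using s by (auto simp: step_Delay_iff)
  let ?d = "f (\<tau> + d) - f \<tau>"
  have "step TA q' (Delay ?d) (dly q' ?d)"
    using warped_can_delay[OF ta f w c(1) q'] by (simp add: step_Delay_iff)
  then show ?thesis using warped_dly[OF w, of d] c(2) Delay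
    by (intro exI[of _ "Delay ?d"] exI[of _ "dly q' ?d"]) auto
next
  case (Act a)
  then obtain g R where e: "(fst q, a, g, R, fst p) \<in> edges TA" "q \<in> states TA" "sat (snd q) g"
      "sat (snd p) (invar TA (fst p))" "snd p = val_reset (snd q) R"
    using s by (auto simp: step_Act_iff)
  have gR: "constr_clocks g \<subseteq> C" "R \<subseteq> C" "fst p \<in> locs TA"
    using e(1) ta unfolding timed_automaton_def by blast+
  then have iC: "constr_clocks (invar TA (fst p)) \<subseteq> C" using ta unfolding timed_automaton_def by blast
  let ?p = "(fst p, val_reset (snd q') R)"
  have wp: "warped f \<tau> C p ?p"
    using w gR(2) e(5) by (auto simp: warped_def val_reset_def)
  have "step TA q' (Act a) ?p"
    using e gR warped_sat[OF f w gR(1)] warped_sat[OF f wp iC] w q'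
    by (auto simp: step_Act_iff warped_def)
  then show ?thesis using wp Act by (intro exI[of _ "Act a"] exI[of _ ?p]) auto
qed

section \<open>Warping whole runs\<close>

definition warped_seq where
  "warped_seq f C st lb st' lb' \<longleftrightarrow> (\<exists>\<tau>. \<forall>i. warped f (\<tau> i) C (st i) (st' i) \<and>
     lbl_delay (lb' i) = f (\<tau> i + lbl_delay (lb i)) - f (\<tau> i))"

lemma warped_seq_sym:
  assumes "warp_fun f" "warped_seq f C st lb st' lb'"
  shows "warped_seq (inv f) C st' lb' st lb"
proof -
  obtain \<tau> where \<tau>: "\<And>i. warped f (\<tau> i) C (st i) (st' i)"
    "\<And>i. lbl_delay (lb' i) = f (\<tau> i + lbl_delay (lb i)) - f (\<tau> i)"
    using assms(2) unfolding warped_seq_def by blast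
  show ?thesis unfolding warped_seq_def
    by (rule exI[of _ "\<lambda>i. f (\<tau> i)"])
       (auto simp: \<tau>(2) warp_fun_inv_apply[OF assms(1)] intro: warped_sym[OF assms(1) \<tau>(1)])
qed

text \<open>Steps are transported one by one, with \<open>\<tau>\<close> plus the elapsed time as
  current time. Divergence survives because \<open>f (\<tau> + m) = f \<tau> + m\<close> for natural
  \<open>m\<close>.\<close>

lemma irun_warp:
  fixes TA :: "('l, 'a, 'p) ta" and lb :: "nat \<Rightarrow> 'a lbl"
  assumes ta: "timed_automaton TA" "clks TA \<subseteq> C" and f: "warp_fun f" and w: "warped f \<tau> C (st 0) q'"
    and r: "irun TA st lb" and q': "q' \<in> states TA"
  obtains st' and lb' :: "nat \<Rightarrow> 'a lbl"
  where "irun TA st' lb'" "st' 0 = q'" "warped_seq f C st lb st' lb'"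
proof -
  define T where "T = (\<lambda>i. \<tau> + (\<Sum>j<i. lbl_delay (lb j)))"
  have T: "T (Suc i) = T i + lbl_delay (lb i)" "T 0 = \<tau>" for i by (simp_all add: T_def)
  have "\<exists>st'. \<forall>i. (warped f (T i) C (st i) (st' i) \<and> st' i \<in> states TA \<and> (i = 0 \<longrightarrow> st' i = q')) \<and>
    (\<exists>l'. step TA (st' i) l' (st' (Suc i)) \<and> lbl_delay l' = f (T (Suc i)) - f (T i))"
  proof (rule dependent_nat_choice)
    show "\<exists>x. warped f (T 0) C (st 0) x \<and> x \<in> states TA \<and> (0 = 0 \<longrightarrow> x = q')"
      using w q' T by auto
  next
    fix p i assume p: "warped f (T i) C (st i) p \<and> p \<in> states TA \<and> (i = 0 \<longrightarrow> p = q')"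
    obtain l' p' where "step TA p l' p'" "lbl_delay l' = f (T i + lbl_delay (lb i)) - f (T i)"
        "warped f (T i + lbl_delay (lb i)) C (st (Suc i)) p'"
      using warped_step[OF ta f _ irun_step[OF r], of "T i" i p] p by blast
    then show "\<exists>p'. (warped f (T (Suc i)) C (st (Suc i)) p' \<and> p' \<in> states TA \<and>
        (Suc i = 0 \<longrightarrow> p' = q')) \<and>
        (\<exists>l'. step TA p l' p' \<and> lbl_delay l' = f (T (Suc i)) - f (T i))"
      using step_target_states[OF ta(1), of p l' p'] T(1)[of i] by (intro exI[of _ p']) auto
  qed
  then obtain st' where st': "\<And>i. warped f (T i) C (st i) (st' i)" "st' 0 = q'"
    "\<And>i. \<exists>l'. step TA (st' i) l' (st' (Suc i)) \<and> lbl_delay l' = f (T (Suc i)) - f (T i)"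
    by auto
  then obtain lb' where lb': "\<And>i. step TA (st' i) (lb' i) (st' (Suc i))"
    "\<And>i. lbl_delay (lb' i) = f (T (Suc i)) - f (T i)" by metis
  have sum: "(\<Sum>i<n. lbl_delay (lb' i)) = f (T n) - f \<tau>" for n
    by (induction n) (auto simp: lb'(2) T(2))
  have "irun TA st' lb'" unfolding irun_def
  proof (intro conjI allI lb'(1))
    fix B :: real
    obtain m :: nat where m: "B \<le> real m" using real_arch_simple by blast
    obtain n where "real m \<le> (\<Sum>i<n. lbl_delay (lb i))" using r unfolding irun_def by blast
    then have "\<tau> + real m \<le> T n" by (simp add: T_def)
    then have "f \<tau> + real m \<le> f (T n)" by (simp add: warp_fun_mono[OF f] flip: warp_fun_add[OF f])
    then show "\<exists>n. B \<le> (\<Sum>i<n. lbl_delay (lb' i))" using m sum by (intro exI[of _ n]) auto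
  qed
  moreover have "warped_seq f C st lb st' lb'"
    unfolding warped_seq_def using st'(1) lb'(2) T(1) by (intro exI[of _ T]) auto
  ultimately show ?thesis using that st'(2) by blast
qed

text \<open>Within transition \<open>i\<close> the map \<open>g i\<close> is an increasing bijection
  between the two delay intervals, so positions correspond in the same order.\<close>

lemma upath_warp:
  assumes f: "warp_fun f" and w: "warped_seq f C st lb st' lb'"
    and r: "irun TA st lb" and r': "irun TA st' lb'"
    and Q1: "\<And>\<tau> q q'. warped f \<tau> C q q' \<Longrightarrow> q \<in> states TA \<Longrightarrow> q' \<in> states TA \<Longrightarrow> q \<in> Q1 \<Longrightarrow> q' \<in> Q1"
    and Q2: "\<And>\<tau> q q'. warped f \<tau> C q q' \<Longrightarrow> q \<in> states TA \<Longrightarrow> q' \<in> states TA \<Longrightarrow> q \<in> Q2 \<Longrightarrow> q' \<in> Q2"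
    and u: "upath st lb Q1 Q2"
  shows "upath st' lb' Q1 Q2"
proof -
  obtain \<tau> where \<tau>: "\<And>i. warped f (\<tau> i) C (st i) (st' i)"
    "\<And>i. lbl_delay (lb' i) = f (\<tau> i + lbl_delay (lb i)) - f (\<tau> i)"
    using w unfolding warped_seq_def by blast
  define g where "g = (\<lambda>i u. f (\<tau> i + u) - f (\<tau> i))"
  have gmono: "g i u \<le> g i v \<longleftrightarrow> u \<le> v" "g i u < g i v \<longleftrightarrow> u < v" for i u v
    by (auto simp: g_def warp_fun_mono[OF f])
  have g0: "g i 0 = 0" and gd: "g i (lbl_delay (lb i)) = lbl_delay (lb' i)" for i
    by (auto simp: g_def \<tau>(2))
  have gsurj: "\<exists>v. u = g i v" for i u
    by (rule exI[of _ "inv f (f (\<tau> i) + u) - \<tau> i"]) (simp add: g_def warp_fun_inv_apply[OF f])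
  have rel: "warped f (\<tau> i + u) C (dly (st i) u) (dly (st' i) (g i u))"
      "dly (st i) u \<in> states TA" "dly (st' i) (g i u) \<in> states TA"
    if "0 \<le> u" "u \<le> lbl_delay (lb i)" for i u
  proof -
    show "warped f (\<tau> i + u) C (dly (st i) u) (dly (st' i) (g i u))"
      unfolding g_def by (rule warped_dly[OF \<tau>(1)])
    show "dly (st i) u \<in> states TA"
      using can_delay_dly_states[OF step_can_delay[OF irun_step[OF r]]] that .
    have "0 \<le> g i u" "g i u \<le> lbl_delay (lb' i)" using that gmono g0 gd by metis+
    then show "dly (st' i) (g i u) \<in> states TA"
      using can_delay_dly_states[OF step_can_delay[OF irun_step[OF r']]] by blast
  qed
  obtain n t where t: "0 \<le> t" "t \<le> lbl_delay (lb n)" "dly (st n) t \<in> Q2"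
    and e1: "\<And>u. 0 \<le> u \<Longrightarrow> u < t \<Longrightarrow> dly (st n) u \<in> Q1"
    and e2: "\<And>j u. j < n \<Longrightarrow> 0 \<le> u \<Longrightarrow> u \<le> lbl_delay (lb j) \<Longrightarrow> dly (st j) u \<in> Q1"
    using u unfolding upath_def by blast
  have "0 \<le> g n t" "g n t \<le> lbl_delay (lb' n)" using t gmono g0 gd by metis+
  moreover have "dly (st' n) (g n t) \<in> Q2" using Q2 rel[of t n] t by blast
  moreover have "dly (st' n) u \<in> Q1" if "0 \<le> u" "u < g n t" for u
  proof -
    obtain v where v: "u = g n v" using gsurj by blast
    then have "0 \<le> v" "v < t" using that gmono g0 by metis+
    then show ?thesis using Q1 rel[of v n] e1 t v by auto
  qed
  moreover have "dly (st' j) u \<in> Q1" if "j < n" "0 \<le> u" "u \<le> lbl_delay (lb' j)" for j u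
  proof -
    obtain v where v: "u = g j v" using gsurj by blast
    then have "0 \<le> v" "v \<le> lbl_delay (lb j)" using that gmono g0 gd by metis+
    then show ?thesis using Q1 rel[of v j] e2 that v by blast
  qed
  ultimately show ?thesis unfolding upath_def by blast
qed

section \<open>Invariance of TCTL, and independence of fresh freeze clocks\<close>

lemma state_reset_eq: "state_reset q z = (fst q, (snd q)(FClk z := 0))"
  by (cases q) simp

lemma warped_id: "warped (\<lambda>t. t) \<tau> C q q' \<longleftrightarrow> fst q' = fst q \<and> (\<forall>x\<in>C. snd q' x = snd q x)"
  by (simp add: warped_def)

lemma clks_no_FClk: "timed_automaton TA \<Longrightarrow> clks TA \<subseteq> - {FClk z}"
  by (auto simp: timed_automaton_def)

text \<open>The identity warp relates states that agree on \<open>C\<close>. Leaving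
  \<open>FClk z\<close> out of \<open>C\<close> thus expresses independence of that clock, here and
  in the freshness lemmas below.\<close>

lemma state_reset_states:
  assumes "timed_automaton TA" "q \<in> states TA"
  shows "state_reset q z \<in> states TA"
proof (rule warped_states[OF assms(1) clks_no_FClk[OF assms(1)] warp_fun_id _ assms(2)])
  show "warped (\<lambda>t. t) 0 (- {FClk z}) q (state_reset q z)"
    by (auto simp: warped_id state_reset_eq)
  show "0 \<le> snd (state_reset q z) x" for x
    using states_nonneg[OF assms(2)] by (simp add: state_reset_eq)
qed

text \<open>The induction varies \<open>f\<close>, \<open>\<tau>\<close> and both states, since
  subformulas are tested at other times of a run and the converse uses the inverse warp.\<close>

lemma tctl_warp:
  assumes ta: "timed_automaton TA" "clks TA \<subseteq> C"
  shows "tctl_clocks \<phi> \<subseteq> C \<Longrightarrow> warp_fun f \<Longrightarrow> warped f \<tau> C q q' \<Longrightarrow> q \<in> states TA \<Longrightarrow>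
    q' \<in> states TA \<Longrightarrow> q \<in> tctl_sem TA \<phi> \<longleftrightarrow> q' \<in> tctl_sem TA \<phi>"
proof (induction \<phi> arbitrary: f \<tau> q q')
  case (TAtom A)
  have "A \<in> labelling TA q \<longleftrightarrow> A \<in> labelling TA q'"
  proof (cases A)
    case (Prop P)
    then show ?thesis using TAtom by (cases q; cases q') (auto simp: warped_def)
  next
    case (Constr g)
    then show ?thesis using TAtom warped_sat_atomic[OF TAtom.prems(2,3), of g]
      by (cases q; cases q') (auto simp: warped_def)
  qed
  then show ?case using TAtom by simp
next
  case (AU \<phi>1 \<phi>2)
  let ?Q1 = "tctl_sem TA \<phi>1 \<union> tctl_sem TA \<phi>2" and ?Q2 = "tctl_sem TA \<phi>2"
  have *: "q' \<in> tctl_sem TA (AU \<phi>1 \<phi>2)" if f: "warp_fun f" and w: "warped f \<tau> C q q'"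
    and q: "q \<in> states TA" "q' \<in> states TA" "q \<in> tctl_sem TA (AU \<phi>1 \<phi>2)" for f \<tau> q q'
    unfolding tctl_sem_AU
  proof (safe)
    fix st' lb' assume r': "irun TA st' lb'" and q': "q' = st' 0"
    \<comment> \<open>\<open>AU\<close> speaks of all runs from \<open>q'\<close>, so a run is
      pulled back along the inverse warp and its until path is pushed forward again.\<close>
    obtain st lb where r: "irun TA st lb" "st 0 = q" "warped_seq (inv f) C st' lb' st lb"
      using irun_warp[OF ta warp_fun_inv[OF f] _ r' q(1), of "f \<tau>"] warped_sym[OF f w] q' by blast
    have ws: "warped_seq f C st lb st' lb'"
      using warped_seq_sym[OF warp_fun_inv[OF f] r(3)] warp_fun_inv_inv[OF f] by simp
    have "upath st lb ?Q1 ?Q2" using q(3) r unfolding tctl_sem_AU by blast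
    then show "upath st' lb' ?Q1 ?Q2"
      by (rule upath_warp[OF f ws r(1) r', rotated 2]) (use AU.IH AU.prems(1) f in auto)
  qed (use q in auto)
  show ?case using *[OF AU.prems(2,3)] *[OF warp_fun_inv warped_sym, OF AU.prems(2,2,3)] AU.prems
    by blast
next
  case (EU \<phi>1 \<phi>2)
  let ?Q1 = "tctl_sem TA \<phi>1 \<union> tctl_sem TA \<phi>2" and ?Q2 = "tctl_sem TA \<phi>2"
  have *: "q' \<in> tctl_sem TA (EU \<phi>1 \<phi>2)" if f: "warp_fun f" and w: "warped f \<tau> C q q'"
    and q: "q \<in> states TA" "q' \<in> states TA" "q \<in> tctl_sem TA (EU \<phi>1 \<phi>2)" for f \<tau> q q'
  proof -
    obtain st lb where r: "irun TA st lb" "st 0 = q" "upath st lb ?Q1 ?Q2"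
      using q(3) unfolding tctl_sem_EU by blast
    obtain st' lb' where r': "irun TA st' lb'" "st' 0 = q'" "warped_seq f C st lb st' lb'"
      using irun_warp[OF ta f _ r(1) q(2), of \<tau>] w r by blast
    have "upath st' lb' ?Q1 ?Q2"
      by (rule upath_warp[OF f r'(3) r(1) r'(1) _ _ r(3)]) (use EU.IH EU.prems(1) f in auto)
    then show ?thesis unfolding tctl_sem_EU using r' by blast
  qed
  show ?case using *[OF EU.prems(2,3)] *[OF warp_fun_inv warped_sym, OF EU.prems(2,2,3)] EU.prems
    by blast
next
  case (TFreeze z \<phi>)
  have "warped f \<tau> C (state_reset q z) (state_reset q' z)"
    using TFreeze.prems by (auto simp: warped_def state_reset_eq)
  then show ?case using TFreeze.IH[OF _ TFreeze.prems(2)] TFreeze.prems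
    by (auto simp: state_reset_states[OF ta(1)])
qed auto

lemma tctl_fresh:
  assumes ta: "timed_automaton TA" and "FClk z \<notin> tctl_clocks \<phi>"
    and "state_reset q z = state_reset q' z" "q \<in> states TA" "q' \<in> states TA"
  shows "q \<in> tctl_sem TA \<phi> \<longleftrightarrow> q' \<in> tctl_sem TA \<phi>"
proof (rule tctl_warp[OF ta clks_no_FClk[OF ta] _ warp_fun_id])
  show "tctl_clocks \<phi> \<subseteq> - {FClk z}" using assms(2) by auto
  show "warped (\<lambda>t. t) 0 (- {FClk z}) q q'"
    using assms(3) by (auto simp: warped_id state_reset_eq fun_eq_iff split: if_splits)
qed (use assms in auto)

lemma divg_fresh:
  assumes ta: "timed_automaton TA" and "state_reset q z = state_reset q' z" "q' \<in> states TA"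
    "q \<in> divg TA"
  shows "q' \<in> divg TA"
proof -
  obtain st lb where r: "irun TA st lb" "st 0 = q" using assms(4) by (auto simp: divg_def)
  have "warped (\<lambda>t. t) 0 (- {FClk z}) (st 0) q'"
    using assms(2) r(2) by (auto simp: warped_id state_reset_eq fun_eq_iff split: if_splits)
  then show ?thesis
    using irun_warp[OF ta clks_no_FClk[OF ta] warp_fun_id _ r(1) assms(3)] unfolding divg_def by blast
qed

lemma step_fresh:
  assumes ta: "timed_automaton TA" and "state_reset q z = state_reset q' z" "q' \<in> states TA"
    "step TA q l p"
  shows "\<exists>p'. step TA q' l p' \<and> state_reset p z = state_reset p' z"
proof -
  have "warped (\<lambda>t. t) 0 (- {FClk z}) q q'"
    using assms(2) by (auto simp: warped_id state_reset_eq fun_eq_iff split: if_splits)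
  then obtain p' where "step TA q' l p'" "warped (\<lambda>t. t) (lbl_delay l) (- {FClk z}) p p'"
    using warped_step[OF ta clks_no_FClk[OF ta] warp_fun_id _ assms(4,3), of 0 z] by auto
  then show ?thesis by (intro exI[of _ p']) (auto simp: warped_id state_reset_eq fun_eq_iff)
qed

lemma state_reset_dly: "state_reset q z = state_reset q' z \<Longrightarrow>
  state_reset (dly q t) z = state_reset (dly q' t) z"
  by (auto simp: state_reset_eq fun_eq_iff split: if_splits)

lemma path_fresh:
  assumes ta: "timed_automaton TA"
    and A: "\<And>q q'. state_reset q z = state_reset q' z \<Longrightarrow> q \<in> states TA \<Longrightarrow> q' \<in> states TA \<Longrightarrow>
      q \<in> A \<Longrightarrow> q' \<in> A"
  shows "path TA A n q D p \<Longrightarrow> state_reset q z = state_reset q' z \<Longrightarrow> q' \<in> states TA \<Longrightarrow>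
    \<exists>p'. path TA A n q' D p' \<and> state_reset p z = state_reset p' z \<and> p' \<in> states TA"
proof (induction arbitrary: q' rule: path.induct)
  case (path_nil q)
  then show ?case by (auto intro: path.path_nil)
next
  case (path_step q l p n D p')
  obtain p1 where p1: "step TA q' l p1" "state_reset p z = state_reset p1 z"
    using step_fresh[OF ta path_step.prems path_step.hyps(1)] by blast
  obtain p2 where p2: "path TA A n p1 D p2" "state_reset p' z = state_reset p2 z" "p2 \<in> states TA"
    using path_step.IH[OF p1(2) step_target_states[OF ta p1(1)]] by blast
  have "dly q' u \<in> A" if "0 \<le> u" "u \<le> lbl_delay l" for u
  proof (rule A[of "dly q u"])
    show "state_reset (dly q u) z = state_reset (dly q' u) z"
      by (rule state_reset_dly[OF path_step.prems(1)])
    show "dly q u \<in> states TA"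
      using can_delay_dly_states[OF step_can_delay[OF path_step.hyps(1)]] that .
    show "dly q' u \<in> states TA"
      using can_delay_dly_states[OF step_can_delay[OF p1(1)]] that .
    show "dly q u \<in> A" using path_step.hyps(2) that .
  qed
  then show ?case using p1(1) p2 path.path_step by blast
qed

section \<open>Truth along delays\<close>

text \<open>Piecewise linear: \<open>[0, a]\<close> goes onto \<open>[0, b]\<close> and
  \<open>[a, \<epsilon>]\<close> onto \<open>[b, \<epsilon>]\<close>; from \<open>\<epsilon>\<close>
  on nothing moves.\<close>

definition bump :: "real \<Rightarrow> real \<Rightarrow> real \<Rightarrow> real \<Rightarrow> real" where
  "bump \<epsilon> a b x = (if x \<le> a then x * (b / a)
     else if x \<le> \<epsilon> then \<epsilon> - (\<epsilon> - x) * ((\<epsilon> - b) / (\<epsilon> - a)) else x)"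

text \<open>The periodic extension: the bump is repeated after every time that differs from
  \<open>e\<close> by an integer.\<close>

definition bump_warp :: "real \<Rightarrow> real \<Rightarrow> real \<Rightarrow> real \<Rightarrow> real \<Rightarrow> real" where
  "bump_warp e \<epsilon> a b t = e + of_int \<lfloor>t - e\<rfloor> + bump \<epsilon> a b (frac (t - e))"

context
  fixes \<epsilon> a b :: real
  assumes a: "0 < a" "a < \<epsilon>" and b: "0 < b" "b < \<epsilon>" and \<epsilon>: "\<epsilon> \<le> 1"
begin

text \<open>Exchanging \<open>a\<close> and \<open>b\<close> inverts both slopes. This gives
  surjectivity of the warp.\<close>

lemma bump_inverse: "bump \<epsilon> b a (bump \<epsilon> a b x) = x"
proof -
  consider "x \<le> a" | "a < x" "x \<le> \<epsilon>" | "\<epsilon> < x" by linarith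
  then show ?thesis
  proof cases
    case 1
    then have "x * (b / a) \<le> b" using a b by (simp add: divide_simps mult.commute)
    then show ?thesis using 1 a b by (simp add: bump_def)
  next
    case 2
    let ?k = "(\<epsilon> - b) / (\<epsilon> - a)"
    have "0 < ?k" using a b by simp
    then have "(\<epsilon> - x) * ?k < (\<epsilon> - a) * ?k" "0 \<le> (\<epsilon> - x) * ?k"
      using 2 mult_strict_right_mono[of "\<epsilon> - x" "\<epsilon> - a" ?k] mult_nonneg_nonneg[of "\<epsilon> - x" ?k] by auto
    moreover have "(\<epsilon> - a) * ?k = \<epsilon> - b" using a by simp
    ultimately have "\<not> \<epsilon> - (\<epsilon> - x) * ?k \<le> b" "\<epsilon> - (\<epsilon> - x) * ?k \<le> \<epsilon>" by auto
    then show ?thesis using 2 a b by (simp add: bump_def)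
  next
    case 3
    then show ?thesis using a b by (simp add: bump_def)
  qed
qed

lemma bump_strict_mono:
  assumes "x < y" shows "bump \<epsilon> a b x < bump \<epsilon> a b y"
proof -
  let ?k = "(\<epsilon> - b) / (\<epsilon> - a)"
  have k: "0 < ?k" "0 < b / a" "(\<epsilon> - a) * ?k = \<epsilon> - b" "a * (b / a) = b" using a b by auto
  have lo: "x * (b / a) \<le> b" if "x \<le> a" for x
    using mult_right_mono[OF that, of "b / a"] k by simp
  have mid: "b < \<epsilon> - (\<epsilon> - x) * ?k" if "a < x" for x
    using mult_strict_right_mono[of "\<epsilon> - x" "\<epsilon> - a" ?k] that k by simp
  have hi: "\<epsilon> - (\<epsilon> - x) * ?k \<le> \<epsilon>" if "x \<le> \<epsilon>" for x
    using mult_nonneg_nonneg[of "\<epsilon> - x" ?k] that k by simp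
  consider "y \<le> a" | "x \<le> a" "a < y" "y \<le> \<epsilon>" | "x \<le> a" "\<epsilon> < y" | "a < x" "y \<le> \<epsilon>"
    | "a < x" "x \<le> \<epsilon>" "\<epsilon> < y" | "\<epsilon> < x" using assms by linarith
  then show ?thesis
  proof cases
    case 1
    then show ?thesis using assms mult_strict_right_mono[OF assms k(2)] by (simp add: bump_def)
  next
    case 2
    then show ?thesis using lo[of x] mid[of y] by (simp add: bump_def)
  next
    case 3
    then show ?thesis using lo[of x] a b by (simp add: bump_def)
  next
    case 4
    then show ?thesis using assms mult_strict_right_mono[of "\<epsilon> - y" "\<epsilon> - x" ?k] k by (simp add: bump_def)
  next
    case 5
    then show ?thesis using hi[of x] by (simp add: bump_def)
  next
    case 6
    then show ?thesis using a assms by (simp add: bump_def)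
  qed
qed

lemma bump_bounds: "0 \<le> x \<Longrightarrow> x < 1 \<Longrightarrow> 0 \<le> bump \<epsilon> a b x \<and> bump \<epsilon> a b x < 1"
proof -
  assume x: "0 \<le> x" "x < 1"
  have 0: "bump \<epsilon> a b 0 = 0" using a by (simp add: bump_def)
  have 1: "bump \<epsilon> a b 1 = 1" using a \<epsilon> b by (auto simp: bump_def)
  show ?thesis using bump_strict_mono[of 0 x] bump_strict_mono[of x 1] 0 1 x by (cases "x = 0") auto
qed

lemma bump_warp_parts: "\<lfloor>bump_warp e \<epsilon> a b t - e\<rfloor> = \<lfloor>t - e\<rfloor>"
  "frac (bump_warp e \<epsilon> a b t - e) = bump \<epsilon> a b (frac (t - e))"
proof -
  have g: "0 \<le> bump \<epsilon> a b (frac (t - e)) \<and> bump \<epsilon> a b (frac (t - e)) < 1"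
    by (rule bump_bounds) (auto simp: frac_lt_1)
  then show fl: "\<lfloor>bump_warp e \<epsilon> a b t - e\<rfloor> = \<lfloor>t - e\<rfloor>"
    by (simp add: bump_warp_def floor_eq_iff)
  show "frac (bump_warp e \<epsilon> a b t - e) = bump \<epsilon> a b (frac (t - e))"
    unfolding frac_def[of "bump_warp e \<epsilon> a b t - e"] fl by (simp add: bump_warp_def)
qed

lemma bump_warp_mono:
  assumes "s < t" shows "bump_warp e \<epsilon> a b s < bump_warp e \<epsilon> a b t"
proof (cases "\<lfloor>s - e\<rfloor> = \<lfloor>t - e\<rfloor>")
  case True
  then have "frac (s - e) < frac (t - e)" using assms by (simp add: frac_def)
  then show ?thesis using True bump_strict_mono by (simp add: bump_warp_def)
next
  case False
  then have "\<lfloor>s - e\<rfloor> + 1 \<le> \<lfloor>t - e\<rfloor>" using assms floor_mono[of "s - e" "t - e"] by linarith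
  then have "real_of_int \<lfloor>s - e\<rfloor> + 1 \<le> of_int \<lfloor>t - e\<rfloor>" by linarith
  moreover have "bump \<epsilon> a b (frac (s - e)) < 1" "0 \<le> bump \<epsilon> a b (frac (t - e))"
    using bump_bounds by (auto simp: frac_lt_1)
  ultimately show ?thesis by (simp add: bump_warp_def)
qed

end

lemma bump_warp_fun:
  assumes a: "0 < a" "a < \<epsilon>" and b: "0 < b" "b < \<epsilon>" and \<epsilon>: "\<epsilon> \<le> 1"
  shows "warp_fun (bump_warp e \<epsilon> a b)"
  unfolding warp_fun_def
proof (intro conjI allI)
  show "strict_mono (bump_warp e \<epsilon> a b)"
    using bump_warp_mono[OF assms] by (simp add: strict_mono_def)
  have "bump_warp e \<epsilon> a b (bump_warp e \<epsilon> b a t) = t" for t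
    unfolding bump_warp_def[of e \<epsilon> a b] bump_warp_parts[OF b a \<epsilon>] bump_inverse[OF b a \<epsilon>]
    by (simp add: frac_def)
  then show "surj (bump_warp e \<epsilon> a b)" by (rule surjI)
  fix t
  have "t + 1 - e = (t - e) + 1" by simp
  then show "bump_warp e \<epsilon> a b (t + 1) = bump_warp e \<epsilon> a b t + 1"
    unfolding bump_warp_def by (simp only: frac_1_eq floor_add_int) (simp add: frac_def)
qed

text \<open>Only fractional parts of \<open>t - e\<close> strictly between \<open>0\<close> and
  \<open>\<epsilon>\<close> can move, and negation turns a nonzero fractional part into its
  complement to \<open>1\<close>.\<close>

lemma bump_warp_fixed:
  assumes "0 < a" "a < \<epsilon>" "\<epsilon> \<le> 1" "frac (e - t) \<le> 1 - \<epsilon>"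
  shows "bump_warp e \<epsilon> a b t = t"
proof -
  have "frac (t - e) = 0 \<or> \<epsilon> \<le> frac (t - e)"
    using assms(4) frac_neg[of "e - t"] by (auto split: if_splits)
  then have "bump \<epsilon> a b (frac (t - e)) = frac (t - e)" 
    using assms by (auto simp: bump_def simp del: frac_eq_0_iff)
  then show ?thesis by (simp add: bump_warp_def frac_def)
qed

lemma bump_warp_moves:
  assumes "0 < a" "a < \<epsilon>" "\<epsilon> \<le> 1"
  shows "bump_warp e \<epsilon> a b (e + a) = e + b"
proof -
  have "\<lfloor>a\<rfloor> = 0" "frac a = a" using assms by (auto simp: floor_eq_iff frac_eq)
  then show ?thesis using assms by (simp add: bump_warp_def bump_def)
qed

text \<open>Two delays between which no relevant clock becomes integral are related by a warp that fixes
  all reset times.\<close>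

lemma tctl_right_constant:
  assumes ta: "timed_automaton TA"
  shows "\<exists>\<epsilon>>0. \<forall>d1 d2. e < d1 \<and> d1 < e + \<epsilon> \<and> e < d2 \<and> d2 < e + \<epsilon> \<and> dly q d1 \<in> states TA \<and>
    dly q d2 \<in> states TA \<and> dly q d1 \<in> tctl_sem TA \<phi> \<longrightarrow> dly q d2 \<in> tctl_sem TA \<phi>"
proof -
  define C where "C = clks TA \<union> tctl_clocks \<phi>"
  have C: "finite C" "clks TA \<subseteq> C" "tctl_clocks \<phi> \<subseteq> C"
    using ta finite_tctl_clocks by (auto simp: C_def timed_automaton_def)
  \<comment> \<open>\<open>1 - frac (e + snd q x)\<close> is the time after \<open>e\<close> until
    clock \<open>x\<close> next has an integral value; \<open>\<epsilon>\<close> is the least such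
    time over \<open>C\<close>, capped at \<open>1\<close>.\<close>
  define \<epsilon> where "\<epsilon> = Min (insert 1 ((\<lambda>x. 1 - frac (e + snd q x)) ` C))"
  have fin: "finite (insert 1 ((\<lambda>x. 1 - frac (e + snd q x)) ` C))" using C by simp
  have \<epsilon>: "0 < \<epsilon>" "\<epsilon> \<le> 1" using fin by (auto simp: \<epsilon>_def frac_lt_1)
  have frac: "frac (e + snd q x) \<le> 1 - \<epsilon>" if "x \<in> C" for x
    using Min_le[OF fin, of "1 - frac (e + snd q x)"] that by (simp add: \<epsilon>_def)
  have "dly q d2 \<in> tctl_sem TA \<phi>"
    if d1: "e < d1" "d1 < e + \<epsilon>" and d2: "e < d2" "d2 < e + \<epsilon>"
      and s: "dly q d1 \<in> states TA" "dly q d2 \<in> states TA" and "dly q d1 \<in> tctl_sem TA \<phi>" for d1 d2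
  proof -
    let ?f = "bump_warp e \<epsilon> (d1 - e) (d2 - e)"
    have f: "warp_fun ?f" using d1 d2 \<epsilon> by (intro bump_warp_fun) auto
    have "?f d1 = d2" using bump_warp_moves[of "d1 - e" \<epsilon> e "d2 - e"] d1 \<epsilon> by simp
    \<comment> \<open>With \<open>q\<close> placed at time \<open>0\<close>, the reset time of
      \<open>x\<close> is \<open>- snd q x\<close> after every delay.\<close>
    moreover have "?f (- snd q x) = - snd q x" if "x \<in> C" for x
      using frac[OF that] d1 \<epsilon> by (intro bump_warp_fixed) auto
    ultimately have "warped ?f d1 C (dly q d1) (dly q d2)" by (auto simp: warped_def)
    then show ?thesis using tctl_warp[OF ta C(2,3) f _ s] that(7) by blast
  qed
  then show ?thesis using \<epsilon>(1) by blast
qed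

section \<open>Semantics of the derived operators\<close>

lemma lrel_env_sem_neg_var:
  "lrel_env_sem TA \<theta> (neg_var Y \<phi>) = lrel_env_sem TA (\<theta>(Y := states TA - \<theta> Y)) \<phi>"
proof (induction \<phi> arbitrary: \<theta>)
  case (Mu Z \<phi>)
  show ?case
  proof (cases "Z = Y")
    case False
    then have "lrel_env_sem TA (\<theta>(Z := S)) (neg_var Y \<phi>) =
        lrel_env_sem TA (\<theta>(Y := states TA - \<theta> Y, Z := S)) \<phi>" for S
      using Mu.IH[of "\<theta>(Z := S)"] unfolding fun_upd_twist[OF False] by (simp add: fun_upd_def)
    then show ?thesis using False by (simp add: fun_upd_def)
  qed (simp add: fun_upd_def cong: if_cong)
qed simp_all

text \<open>Complementation in \<open>states TA\<close> exchanges pre-fixed points of the dual body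
  with post-fixed points of \<open>\<phi>\<close>.\<close>

lemma lrel_env_sem_Nu:
  "lrel_env_sem TA \<theta> (Nu Y \<phi>) = \<Union>{T. T \<subseteq> states TA \<and> T \<subseteq> lrel_env_sem TA (\<theta>(Y := T)) \<phi>}"
proof -
  let ?F = "\<lambda>T. lrel_env_sem TA (\<theta>(Y := T)) \<phi>"
  have eq: "lrel_env_sem TA \<theta> (Nu Y \<phi>) =
    states TA - \<Inter>{S. S \<subseteq> states TA \<and> states TA - ?F (states TA - S) \<subseteq> S}"
    by (simp add: Nu_def lrel_env_sem_neg_var)
  show ?thesis
  proof (intro equalityI subsetI)
    fix q assume "q \<in> lrel_env_sem TA \<theta> (Nu Y \<phi>)"
    then obtain S where "S \<subseteq> states TA" "states TA - ?F (states TA - S) \<subseteq> S" "q \<in> states TA - S"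
      unfolding eq by blast
    then show "q \<in> \<Union>{T. T \<subseteq> states TA \<and> T \<subseteq> ?F T}" by blast
  next
    fix q assume "q \<in> \<Union>{T. T \<subseteq> states TA \<and> T \<subseteq> ?F T}"
    then obtain T where T: "T \<subseteq> states TA" "T \<subseteq> ?F T" "q \<in> T" by blast
    then have "states TA - (states TA - T) = T" by blast
    then have "states TA - ?F (states TA - (states TA - T)) \<subseteq> states TA - T" using T by auto
    then show "q \<in> lrel_env_sem TA \<theta> (Nu Y \<phi>)" unfolding eq using T by blast
  qed
qed

text \<open>Negation is relative to \<open>states TA\<close>, whereas an environment may assign
  arbitrary sets to variables; one conjunct inside \<open>states TA\<close> confines the
  intersection.\<close>

lemma lrel_env_sem_And:
  assumes "lrel_env_sem TA \<theta> \<phi>1 \<subseteq> states TA"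
  shows "lrel_env_sem TA \<theta> (And \<phi>1 \<phi>2) = lrel_env_sem TA \<theta> \<phi>1 \<inter> lrel_env_sem TA \<theta> \<phi>2"
  using assms by (auto simp: And_def)

lemma lrel_env_sem_Imp:
  "lrel_env_sem TA \<theta> (Imp \<phi>1 \<phi>2) = (states TA - lrel_env_sem TA \<theta> \<phi>1) \<union> lrel_env_sem TA \<theta> \<phi>2"
  by (simp add: Imp_def)

lemma lrel_env_sem_Box:
  assumes "timed_automaton TA"
  shows "lrel_env_sem TA \<theta> (Box K \<phi>) =
    {q \<in> states TA. \<forall>a\<in>K. \<forall>p. step TA q (Act a) p \<longrightarrow> p \<in> lrel_env_sem TA \<theta> \<phi>}"
proof -
  have "p \<in> states TA" if "step TA q (Act a) p" for q a p
    using step_target_states[OF assms that] .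
  then show ?thesis unfolding Box_def lrel_env_sem.simps by blast
qed

lemma lrel_env_sem_cmp_atom:
  "lrel_env_sem TA \<theta> (cmp_atom x r c) = {q \<in> states TA. cmp_sem r (snd q x) (real c)}"
  by (auto simp: cmp_atom_def)

lemma lrel_env_sem_Ex:
  "lrel_env_sem TA \<theta> (Ex \<phi>1 \<phi>2) = {q. \<exists>d. can_delay TA q d \<and> dly q d \<in> lrel_env_sem TA \<theta> \<phi>2 \<and>
     (\<forall>u. 0 \<le> u \<and> u < d \<longrightarrow> dly q u \<in> lrel_env_sem TA \<theta> \<phi>1 \<union> lrel_env_sem TA \<theta> \<phi>2)}"
  (is "?L = ?R")
proof (intro equalityI subsetI)
  fix q assume "q \<in> ?L"
  then show "q \<in> ?R" unfolding lrel_env_sem.simps step_Delay_iff by blast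
next
  fix q assume "q \<in> ?R"
  then obtain d where d: "can_delay TA q d" "dly q d \<in> lrel_env_sem TA \<theta> \<phi>2"
    "\<And>u. 0 \<le> u \<Longrightarrow> u < d \<Longrightarrow> dly q u \<in> lrel_env_sem TA \<theta> \<phi>1 \<union> lrel_env_sem TA \<theta> \<phi>2" by blast
  have "can_delay TA q u" if "0 \<le> u" "u < d" for u using can_delay_le[OF d(1)] that by simp
  then show "q \<in> ?L" unfolding lrel_env_sem.simps step_Delay_iff
    using d can_delay_states[OF d(1)] can_delay_nonneg[OF d(1)] by blast
qed

lemma lrel_env_sem_FF: "lrel_env_sem TA \<theta> FF = {}"
proof -
  have "\<not> snd q (AClk 0) < 0" if "q \<in> states TA" for q
    using states_nonneg[OF that, of "AClk 0"] by simp
  then show ?thesis unfolding FF_def lrel_env_sem_cmp_atom by simp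
qed

lemma lrel_env_sem_TT: "lrel_env_sem TA \<theta> TT = states TA"
  unfolding TT_def lrel_env_sem_cmp_atom by (simp add: states_nonneg cong: conj_cong)

lemma lrel_env_sem_All_FF:
  "lrel_env_sem TA \<theta> (All FF \<phi>) =
    {q \<in> states TA. \<forall>d. can_delay TA q d \<longrightarrow> dly q d \<in> lrel_env_sem TA \<theta> \<phi>}"
proof -
  have "lrel_env_sem TA \<theta> (Ex (Neg FF) (Neg \<phi>)) =
    {q. \<exists>d. can_delay TA q d \<and> dly q d \<notin> lrel_env_sem TA \<theta> \<phi>}" (is "?L = ?R")
    unfolding lrel_env_sem_Ex lrel_env_sem.simps(3) lrel_env_sem_FF
  proof (intro equalityI subsetI)
    fix q assume "q \<in> ?R"
    then obtain d where d: "can_delay TA q d" "dly q d \<notin> lrel_env_sem TA \<theta> \<phi>" by blast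
    then have "dly q u \<in> states TA" if "0 \<le> u" "u \<le> d" for u
      using can_delay_dly_states that by blast
    then show "q \<in> {q. \<exists>d. can_delay TA q d \<and> dly q d \<in> states TA - lrel_env_sem TA \<theta> \<phi> \<and>
        (\<forall>u. 0 \<le> u \<and> u < d \<longrightarrow> dly q u \<in> (states TA - {}) \<union> (states TA - lrel_env_sem TA \<theta> \<phi>))}"
      using d can_delay_nonneg[OF d(1)] by (auto intro!: exI[of _ d])
  qed blast
  then show ?thesis unfolding All_def lrel_env_sem.simps(3) by blast
qed

section \<open>Time stops and time divergence as formulas\<close>

definition time_stop :: "('l, 'a, 'p) ta \<Rightarrow> 'l state set" where
  "time_stop TA = {q \<in> states TA. \<forall>d. can_delay TA q d \<longrightarrow> d < 1}"

lemma can_delay_fresh: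
  assumes "timed_automaton TA" "state_reset q z = state_reset q' z" "q' \<in> states TA" "can_delay TA q d"
  shows "can_delay TA q' d"
  using step_fresh[OF assms(1-3), of "Delay d" "dly q d"] assms(4) by (auto simp: step_Delay_iff)

lemma state_reset_idem [simp]: "state_reset (state_reset q z) z = state_reset q z"
  by (simp add: state_reset_eq)

text \<open>Resetting a freeze clock does not change the possible delays, and afterwards that clock
  reads the delay, so the atom in \<open>TS\<close> bounds it.\<close>

lemma lrel_env_sem_TS:
  assumes ta: "timed_automaton TA"
  shows "lrel_env_sem TA \<theta> TS = time_stop TA"
proof -
  have "can_delay TA (state_reset q 0) d \<longleftrightarrow> can_delay TA q d" if "q \<in> states TA" for q d
    using can_delay_fresh[OF ta, of q 0 "state_reset q 0" d]
      can_delay_fresh[OF ta, of "state_reset q 0" 0 q d] that state_reset_states[OF ta that, of 0] by auto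
  moreover have "snd (state_reset q 0) (FClk 0) = 0" for q :: "'a state" by (simp add: state_reset_eq)
  moreover have "dly (state_reset q 0) d \<in> states TA" if "can_delay TA (state_reset q 0) d" for q d
    using can_delay_dly_states[OF that] can_delay_nonneg[OF that] by simp
  ultimately show ?thesis
    unfolding TS_def lrel_env_sem.simps(7) lrel_env_sem_All_FF lrel_env_sem_cmp_atom time_stop_def
    using state_reset_states[OF ta] by auto
qed

lemma lrel_env_sem_au:
  assumes ta: "timed_automaton TA" and G1: "lrel_env_sem TA \<theta> \<gamma>1 = G1" and G2: "lrel_env_sem TA \<theta> \<gamma>2 = G2"
  shows "lrel_env_sem TA \<theta> (au \<gamma>1 \<gamma>2) = {q. \<exists>d. can_delay TA q d \<and>
    (dly q d \<in> G2 \<or> dly q d \<in> time_stop TA \<and> (\<forall>e. can_delay TA q (d + e) \<and> 0 \<le> e \<longrightarrow> dly q (d + e) \<in> G1)) \<and>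
    (\<forall>u. 0 \<le> u \<and> u < d \<longrightarrow> dly q u \<in> G1 \<union> G2)}"
proof -
  let ?H = "{q \<in> states TA. \<forall>d. can_delay TA q d \<longrightarrow> dly q d \<in> G1}"
  have H: "lrel_env_sem TA \<theta> (Or \<gamma>2 (And TS (All FF \<gamma>1))) = G2 \<union> (time_stop TA \<inter> ?H)"
  proof -
    have "lrel_env_sem TA \<theta> (And TS (All FF \<gamma>1)) = time_stop TA \<inter> ?H"
      by (subst lrel_env_sem_And) (auto simp: lrel_env_sem_TS[OF ta] lrel_env_sem_All_FF G1 time_stop_def)
    then show ?thesis by (simp add: G2)
  qed
  \<comment> \<open>Delay \<open>0\<close> shows \<open>?H \<subseteq> G1\<close>, so the time-stop
    disjunct adds nothing to what may hold before \<open>d\<close>.\<close>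
  have sub: "?H \<subseteq> G1"
  proof
    fix q assume "q \<in> ?H"
    then have "q \<in> states TA" "can_delay TA q 0 \<longrightarrow> dly q 0 \<in> G1" by blast+
    then show "q \<in> G1" by simp
  qed
  have eq: "dly q d \<in> ?H \<longleftrightarrow> (\<forall>e. can_delay TA q (d + e) \<and> 0 \<le> e \<longrightarrow> dly q (d + e) \<in> G1)"
    if d: "can_delay TA q d" for q d
  proof -
    have "can_delay TA (dly q d) e \<longleftrightarrow> can_delay TA q (d + e) \<and> 0 \<le> e" for e
      using can_delay_add[OF d] can_delay_nonneg[of TA "dly q d" e] can_delay_dly[of TA q "d + e" d]
        can_delay_nonneg[OF d] by auto
    then show ?thesis using can_delay_dly_states[OF d, of d] can_delay_nonneg[OF d] by simp
  qed
  show ?thesis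
    unfolding au_def lrel_env_sem_Ex G1 H
  proof (intro Collect_cong ex_cong1 conj_cong refl)
    fix q d assume "can_delay TA q d"
    from eq[OF this] show "dly q d \<in> G2 \<union> (time_stop TA \<inter> ?H) \<longleftrightarrow> dly q d \<in> G2 \<or> dly q d \<in> time_stop TA \<and>
        (\<forall>e. can_delay TA q (d + e) \<and> 0 \<le> e \<longrightarrow> dly q (d + e) \<in> G1)" by blast
    have "G1 \<union> (G2 \<union> (time_stop TA \<inter> ?H)) = G1 \<union> G2" using sub by blast
    then show "(\<forall>u. 0 \<le> u \<and> u < d \<longrightarrow> dly q u \<in> G1 \<union> (G2 \<union> (time_stop TA \<inter> ?H))) \<longleftrightarrow>
        (\<forall>u. 0 \<le> u \<and> u < d \<longrightarrow> dly q u \<in> G1 \<union> G2)" by (simp only:)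
  qed
qed

text \<open>For one inclusion \<open>divg TA\<close> is a post-fixed point, by induction on the
  transitions needed to bring the clock to \<open>1\<close>. For the other, each round of the
  fixpoint yields a path of duration at least \<open>1\<close> back into \<open>T\<close>.\<close>

lemma lrel_env_sem_TDIV:
  fixes TA :: "('l, 'a, 'p) ta"
  assumes ta: "timed_automaton TA"
  shows "lrel_env_sem TA \<theta> TDIV = divg TA"
proof -
  \<comment> \<open>One unfolding of the inner fixpoint: time passes, then either the round is
    completed in \<open>T\<close> or an action leads into \<open>S\<close>.\<close>
  define E where "E = (\<lambda>T S. {q. \<exists>d. can_delay TA q d \<and>
    (dly q d \<in> T \<and> 1 \<le> snd (dly q d) (FClk 0) \<or> (\<exists>a p. step TA (dly q d) (Act a) p \<and> p \<in> S))})"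
  let ?\<psi> = "Ex TT (Or (And (cmp_atom (FClk 0) Ge 1) (Var 0)) (Dia UNIV (Var 1)))"
  have E: "lrel_env_sem TA (\<eta>(0 := T, 1 := S)) ?\<psi> = E T S" if "T \<subseteq> states TA" for \<eta> T S
  proof -
    have *: "lrel_env_sem TA (\<eta>(0 := T, 1 := S)) (And (cmp_atom (FClk 0) Ge 1) (Var 0)) =
        {q \<in> T. 1 \<le> snd q (FClk 0)}"
      using that by (subst lrel_env_sem_And) (auto simp: lrel_env_sem_cmp_atom)
    have **: "lrel_env_sem TA (\<eta>(0 := T, 1 := S)) (Dia UNIV (Var 1)) =
        {q. \<exists>a p. step TA q (Act a) p \<and> p \<in> S}"
      using step_states[of TA] by auto
    have "dly q u \<in> states TA" if "can_delay TA q d" "0 \<le> u" "u < d" for q d u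
      using can_delay_dly_states[OF that(1,2)] that(3) by simp
    then show ?thesis
      unfolding lrel_env_sem_Ex lrel_env_sem_TT lrel_env_sem.simps(4) * ** E_def by blast
  qed
  have sem: "lrel_env_sem TA \<theta> TDIV = \<Union>{T. T \<subseteq> states TA \<and> T \<subseteq> {q \<in> states TA. state_reset q 0 \<in>
      \<Inter>{S. S \<subseteq> states TA \<and> E T S \<subseteq> S}}}"
    unfolding TDIV_def lrel_env_sem_Nu lrel_env_sem.simps(7,8)
    by (intro arg_cong[where f = Union] Collect_cong conj_cong refl) (simp only: E)
  show ?thesis
  proof (intro equalityI subsetI)
    fix q assume q: "q \<in> divg TA"
    have main: "st 0 \<in> E (divg TA) S"
      if S: "E (divg TA) S \<subseteq> S" and "irun TA st lb"
        "1 \<le> snd (st 0) (FClk 0) + (\<Sum>i<n. lbl_delay (lb i))" for S n st and lb :: "nat \<Rightarrow> 'a lbl"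
      using that(2,3)
    proof (induction n arbitrary: st lb)
      case 0
      then have "dly (st 0) 0 \<in> divg TA" unfolding divg_def by auto
      moreover have "can_delay TA (st 0) 0" using step_states[OF irun_step[OF 0(1)]] by simp
      moreover have "1 \<le> snd (dly (st 0) 0) (FClk 0)" using 0(2) by simp
      ultimately show ?case unfolding E_def by blast
    next
      case (Suc n)
      have s: "step TA (st 0) (lb 0) (st 1)" using irun_step[OF Suc.prems(1), of 0] by simp
      have "st (Suc 0) \<in> E (divg TA) S"
        using Suc.prems(2) step_FClk[OF ta s, of 0]
        by (intro Suc.IH[OF irun_tl[OF Suc.prems(1)]])
           (simp add: sum.lessThan_Suc_shift del: sum.lessThan_Suc)
      then have 1: "st 1 \<in> E (divg TA) S" by simp
      show ?case
      proof (cases "lb 0")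
        case (Act a)
        then have "step TA (dly (st 0) 0) (Act a) (st 1)" "can_delay TA (st 0) 0"
          using s step_states[OF s] by auto
        then show ?thesis using 1 S unfolding E_def by blast
      next
        \<comment> \<open>The inner formula recurs only after an action, so this delay is merged
          with the one supplied by the next state.\<close>
        case (Delay d)
        then have d: "can_delay TA (st 0) d" "st 1 = dly (st 0) d" using s by (auto simp: step_Delay_iff)
        obtain e where "can_delay TA (st 1) e" "dly (st 1) e \<in> divg TA \<and> 1 \<le> snd (dly (st 1) e) (FClk 0) \<or>
            (\<exists>a p. step TA (dly (st 1) e) (Act a) p \<and> p \<in> S)"
          using 1 unfolding E_def by blast
        moreover from this have "can_delay TA (st 0) (d + e)" using d can_delay_add[OF d(1)] by simp
        moreover have "dly (st 0) (d + e) = dly (st 1) e" using d by simp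
        ultimately show ?thesis unfolding E_def by (metis (mono_tags, lifting) mem_Collect_eq)
      qed
    qed
    have "state_reset p 0 \<in> E (divg TA) S" if S: "E (divg TA) S \<subseteq> S" and p: "p \<in> divg TA" for S p
    proof -
      have ps: "p \<in> states TA" using p divg_states by blast
      have "state_reset p 0 \<in> divg TA"
        by (rule divg_fresh[OF ta _ _ p, of 0]) (auto simp: state_reset_states[OF ta ps])
      then obtain st and lb :: "nat \<Rightarrow> 'a lbl" where r: "irun TA st lb" "st 0 = state_reset p 0"
        unfolding divg_def by blast
      obtain n where "1 \<le> (\<Sum>i<n. lbl_delay (lb i))" using r unfolding irun_def by blast
      moreover have "snd (st 0) (FClk 0) = 0" using r by (simp add: state_reset_eq)
      ultimately show ?thesis using main[OF S r(1), of n] r(2) by simp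
    qed
    then have "divg TA \<subseteq> {q \<in> states TA. state_reset q 0 \<in> \<Inter>{S. S \<subseteq> states TA \<and> E (divg TA) S \<subseteq> S}}"
      using divg_states[of TA] by blast
    then show "q \<in> lrel_env_sem TA \<theta> TDIV" unfolding sem using q divg_states[of TA] by blast
  next
    fix q assume "q \<in> lrel_env_sem TA \<theta> TDIV"
    then obtain T where T: "T \<subseteq> states TA" "q \<in> T" and
      "T \<subseteq> {q \<in> states TA. state_reset q 0 \<in> \<Inter>{S. S \<subseteq> states TA \<and> E T S \<subseteq> S}}"
      unfolding sem by blast
    then have T3: "state_reset p 0 \<in> S" if "p \<in> T" "S \<subseteq> states TA" "E T S \<subseteq> S" for p S
      using that by blast
    \<comment> \<open>A pre-fixed point of \<open>E T\<close>: what the clock already shows plus the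
      duration still to come is at least \<open>1\<close>.\<close>
    define S where "S = {s \<in> states TA. \<exists>n D p. path TA UNIV n s D p \<and> p \<in> T \<and> 1 \<le> snd s (FClk 0) + D}"
    have "E T S \<subseteq> S"
    proof
      fix s assume "s \<in> E T S"
      then obtain d where d: "can_delay TA s d" and
        c: "dly s d \<in> T \<and> 1 \<le> snd (dly s d) (FClk 0) \<or> (\<exists>a p. step TA (dly s d) (Act a) p \<and> p \<in> S)"
        unfolding E_def by blast
      have st: "step TA s (Delay d) (dly s d)" using d by (simp add: step_Delay_iff)
      have sd: "path TA UNIV n (dly s d) D p \<Longrightarrow> path TA UNIV (Suc n) s (d + D) p" for n D p
        using path_step[OF st, of UNIV n D p] by simp
      from c show "s \<in> S"
      proof
        assume "dly s d \<in> T \<and> 1 \<le> snd (dly s d) (FClk 0)"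
        then have "path TA UNIV (Suc 0) s (d + 0) (dly s d)" "dly s d \<in> T" "1 \<le> snd s (FClk 0) + (d + 0)"
          using sd[OF path_nil] by auto
        then show ?thesis unfolding S_def using can_delay_states[OF d] by blast
      next
        assume "\<exists>a p. step TA (dly s d) (Act a) p \<and> p \<in> S"
        then obtain a p n D p' where p: "step TA (dly s d) (Act a) p" "path TA UNIV n p D p'" "p' \<in> T"
          "1 \<le> snd p (FClk 0) + D" unfolding S_def by blast
        have "path TA UNIV (Suc (Suc n)) s (d + D) p'"
          using sd path_step[OF p(1) _ p(2)] by simp
        moreover have "snd p (FClk 0) = snd s (FClk 0) + d" using step_FClk[OF ta p(1)] by simp
        then have "1 \<le> snd s (FClk 0) + (d + D)" using p(4) by simp
        ultimately show ?thesis unfolding S_def using p(3) can_delay_states[OF d] by blast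
      qed
    qed
    from T3[OF _ _ this] have TS: "state_reset p 0 \<in> S" if "p \<in> T" for p
      using that unfolding S_def by blast
    \<comment> \<open>Each round first resets \<open>FClk 0\<close>, so the path found starts at the
      reset state. Closing \<open>T\<close> under changes of this clock lets
      \<open>path_fresh\<close> start it at the original state instead.\<close>
    define X where "X = {p \<in> states TA. \<exists>p'\<in>T. state_reset p 0 = state_reset p' 0}"
    have "\<exists>n D p'. 1 \<le> D \<and> path TA UNIV n p D p' \<and> p' \<in> X" if "p \<in> X" for p
    proof -
      obtain p1 where p1: "p1 \<in> T" "state_reset p 0 = state_reset p1 0" "p \<in> states TA"
        using \<open>p \<in> X\<close> unfolding X_def by blast
      obtain n D p2 where p2: "path TA UNIV n (state_reset p1 0) D p2" "p2 \<in> T"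
        "1 \<le> snd (state_reset p1 0) (FClk 0) + D"
        using TS[OF p1(1)] unfolding S_def by blast
      have "1 \<le> D" using p2(3) by (simp add: state_reset_eq)
      moreover obtain p3 where "path TA UNIV n p D p3" "state_reset p2 0 = state_reset p3 0" "p3 \<in> states TA"
        using path_fresh[OF ta _ p2(1), of 0 p] p1 by auto
      moreover from this have "p3 \<in> X" unfolding X_def using p2(2) by (auto intro!: bexI[of _ p2])
      ultimately show ?thesis by blast
    qed
    moreover have "q \<in> X" using T by (auto simp: X_def)
    ultimately obtain st and lb :: "nat \<Rightarrow> 'a lbl" where "irun TA st lb" "st 0 = q"
      using irun_of_paths[of X TA UNIV q] by blast
    then show "q \<in> divg TA" unfolding divg_def by blast
  qed
qed

section \<open>Fixpoint characterizations of until\<close>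

definition eu_step :: "('l, 'a, 'p) ta \<Rightarrow> 'l state set \<Rightarrow> 'l state set \<Rightarrow> 'l state set \<Rightarrow> 'l state set" where
  "eu_step TA Q1 Q2 S =
    (let W = (Q2 \<inter> divg TA) \<union> (Q1 \<inter> {q. \<exists>a p. step TA q (Act a) p \<and> p \<in> S})
     in {q. \<exists>d. can_delay TA q d \<and> dly q d \<in> W \<and> (\<forall>u. 0 \<le> u \<and> u < d \<longrightarrow> dly q u \<in> Q1 \<union> W)})"

lemma eu_stepI:
  assumes "can_delay TA q d"
    and "dly q d \<in> Q2 \<inter> divg TA \<or> dly q d \<in> Q1 \<and> (\<exists>a p. step TA (dly q d) (Act a) p \<and> p \<in> S)"
    and "\<And>u. 0 \<le> u \<Longrightarrow> u < d \<Longrightarrow> dly q u \<in> Q1 \<union> (Q2 \<inter> divg TA)"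
  shows "q \<in> eu_step TA Q1 Q2 S"
  unfolding eu_step_def Let_def using assms by blast

text \<open>A run may delay several times in a row, while one unfolding has a single delay before
  its action; a further delay is merged in front here.\<close>

lemma eu_step_dly:
  assumes d: "can_delay TA q d" and q: "dly q d \<in> eu_step TA Q1 Q2 S"
    and u: "\<And>u. 0 \<le> u \<Longrightarrow> u < d \<Longrightarrow> dly q u \<in> Q1 \<union> (Q2 \<inter> divg TA)"
  shows "q \<in> eu_step TA Q1 Q2 S"
proof -
  define W where "W = (Q2 \<inter> divg TA) \<union> (Q1 \<inter> {q. \<exists>a p. step TA q (Act a) p \<and> p \<in> S})"
  obtain e where e: "can_delay TA (dly q d) e" "dly q (d + e) \<in> W"
      "\<And>u. 0 \<le> u \<Longrightarrow> u < e \<Longrightarrow> dly q (d + u) \<in> Q1 \<union> W"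
    using q unfolding eu_step_def Let_def W_def[symmetric] by auto
  have "dly q v \<in> Q1 \<union> W" if "0 \<le> v" "v < d + e" for v
  proof (cases "v < d")
    case True
    then show ?thesis using u[of v] that by (auto simp: W_def)
  next
    case False
    then show ?thesis using e(3)[of "v - d"] that by simp
  qed
  then show ?thesis
    unfolding eu_step_def Let_def W_def[symmetric] using can_delay_add[OF d e(1)] e(2) by blast
qed

text \<open>Starts of until paths lie in every pre-fixed point, by induction on the index of the
  transition that contains the witness; and they form a pre-fixed point themselves.\<close>

lemma eu_fixpoint:
  fixes TA :: "('l, 'a, 'p) ta"
  shows "{q. \<exists>st lb. irun TA st lb \<and> st 0 = q \<and> upath st lb (Q1 \<union> Q2) Q2} =
    \<Inter>{S. S \<subseteq> states TA \<and> eu_step TA Q1 Q2 S \<subseteq> S}" (is "?U = _")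
proof (intro equalityI subsetI)
  have main: "st 0 \<in> eu_step TA Q1 Q2 S"
    if S: "eu_step TA Q1 Q2 S \<subseteq> S" and "irun TA st lb" "0 \<le> t" "t \<le> lbl_delay (lb n)" "dly (st n) t \<in> Q2"
      "\<forall>u. 0 \<le> u \<and> u < t \<longrightarrow> dly (st n) u \<in> Q1 \<union> Q2"
      "\<forall>j<n. \<forall>u. 0 \<le> u \<and> u \<le> lbl_delay (lb j) \<longrightarrow> dly (st j) u \<in> Q1 \<union> Q2"
    for S st n t and lb :: "nat \<Rightarrow> 'a lbl"
    using that(2-)
  proof (induction n arbitrary: st lb)
    case 0
    show ?case
    proof (rule eu_stepI[where d = t])
      show "can_delay TA (st 0) t"
        using can_delay_le[OF step_can_delay[OF irun_step[OF 0(1)]] 0(2,3)] .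
      show "dly (st 0) t \<in> Q2 \<inter> divg TA \<or>
          dly (st 0) t \<in> Q1 \<and> (\<exists>a p. step TA (dly (st 0) t) (Act a) p \<and> p \<in> S)"
        using irun_divg[OF 0(1,2,3)] 0(4) by blast
      show "dly (st 0) u \<in> Q1 \<union> (Q2 \<inter> divg TA)" if "0 \<le> u" "u < t" for u
        using irun_divg[OF 0(1) that(1)] that 0(3,5) by auto
    qed
  next
    case (Suc n)
    have s: "step TA (st 0) (lb 0) (st 1)" using irun_step[OF Suc.prems(1), of 0] by simp
    have "st (Suc 0) \<in> eu_step TA Q1 Q2 S"
      by (rule Suc.IH[OF irun_tl[OF Suc.prems(1)]]) (use Suc.prems in auto)
    then have 1: "st 1 \<in> eu_step TA Q1 Q2 S" by simp
    have Q: "dly (st 0) u \<in> Q1 \<union> (Q2 \<inter> divg TA)" if "0 \<le> u" "u \<le> lbl_delay (lb 0)" for u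
      using irun_divg[OF Suc.prems(1) that] Suc.prems(6) that by blast
    show ?case
    proof (cases "lb 0")
      case (Act a)
      have "step TA (dly (st 0) 0) (Act a) (st 1)" using s Act by simp
      then show ?thesis
        using Q[of 0] Act 1 S step_states[OF s] by (intro eu_stepI[where d = 0]) auto
    next
      case (Delay d)
      then have d: "can_delay TA (st 0) d" "st 1 = dly (st 0) d" using s by (auto simp: step_Delay_iff)
      show ?thesis by (rule eu_step_dly[OF d(1)]) (use 1 d(2) Q Delay in auto)
    qed
  qed
  fix q assume "q \<in> ?U"
  then obtain st and lb :: "nat \<Rightarrow> 'a lbl" where r: "irun TA st lb" "st 0 = q" "upath st lb (Q1 \<union> Q2) Q2"
    by blast
  then show "q \<in> \<Inter>{S. S \<subseteq> states TA \<and> eu_step TA Q1 Q2 S \<subseteq> S}"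
    using main[OF _ r(1)] unfolding upath_def by blast
next
  fix q assume q: "q \<in> \<Inter>{S. S \<subseteq> states TA \<and> eu_step TA Q1 Q2 S \<subseteq> S}"
  have cons: "q \<in> ?U" if s: "step TA q l p" "p \<in> ?U"
    and Q: "\<And>u. 0 \<le> u \<Longrightarrow> u \<le> lbl_delay l \<Longrightarrow> dly q u \<in> Q1 \<union> Q2" for q p l
  proof -
    obtain st and lb :: "nat \<Rightarrow> 'a lbl" where r: "irun TA st lb" "st 0 = p" "upath st lb (Q1 \<union> Q2) Q2"
      using s(2) by blast
    have "irun TA (case_nat q st) (case_nat l lb)" using s(1) r by (intro irun_Cons) auto
    moreover have "upath (case_nat q st) (case_nat l lb) (Q1 \<union> Q2) Q2"
      using r(3) Q by (subst upath_unfold) auto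
    ultimately show ?thesis by force
  qed
  \<comment> \<open>Once \<open>Q2\<close> holds, any run will do, and divergence guarantees
    one.\<close>
  have now: "q \<in> ?U" if "q \<in> Q2" "q \<in> divg TA" for q
  proof -
    obtain st and lb :: "nat \<Rightarrow> 'a lbl" where r: "irun TA st lb" "st 0 = q"
      using \<open>q \<in> divg TA\<close> unfolding divg_def by blast
    then have "upath st lb (Q1 \<union> Q2) Q2"
      using that(1) step_delay_nonneg[OF irun_step[OF r(1), of 0]]
      by (subst upath_unfold) (auto intro!: exI[of _ "0 :: real"])
    then show ?thesis using r by blast
  qed
  have "eu_step TA Q1 Q2 ?U \<subseteq> ?U"
  proof
    fix s assume "s \<in> eu_step TA Q1 Q2 ?U"
    then obtain d where d: "can_delay TA s d"
        "dly s d \<in> Q2 \<inter> divg TA \<or> dly s d \<in> Q1 \<and> (\<exists>a p. step TA (dly s d) (Act a) p \<and> p \<in> ?U)"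
        "\<And>u. 0 \<le> u \<Longrightarrow> u < d \<Longrightarrow> dly s u \<in> Q1 \<union> Q2"
      unfolding eu_step_def Let_def by blast
    have sd: "step TA s (Delay d) (dly s d)" using d(1) by (simp add: step_Delay_iff)
    have end': "dly s d \<in> ?U"
    proof (cases "dly s d \<in> Q2 \<inter> divg TA")
      case True
      then show ?thesis using now by blast
    next
      case False
      then obtain a p where p: "dly s d \<in> Q1" "step TA (dly s d) (Act a) p" "p \<in> ?U" using d(2) by blast
      show ?thesis by (rule cons[OF p(2,3)]) (use p(1) in auto)
    qed
    show "s \<in> ?U"
    proof (rule cons[OF sd end'])
      fix u assume "0 \<le> u" "u \<le> lbl_delay (Delay d :: 'a lbl)"
      then show "dly s u \<in> Q1 \<union> Q2" using d(2) d(3)[of u] by (cases "u = d") auto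
    qed
  qed
  moreover have "?U \<subseteq> states TA"
  proof
    fix s assume "s \<in> ?U"
    then obtain st and lb :: "nat \<Rightarrow> 'a lbl" where r: "irun TA st lb" "st 0 = s" by blast
    then show "s \<in> states TA" using step_states[OF irun_step[OF r(1), of 0]] by simp
  qed
  ultimately show "q \<in> ?U" using q by blast
qed

section \<open>The nested fixpoint for \<open>AU\<close>\<close>

definition au_guard :: "('l, 'a, 'p) ta \<Rightarrow> nat \<Rightarrow> 'l state set \<Rightarrow> 'l state set \<Rightarrow> 'l state set \<Rightarrow> 'l state set"
  where "au_guard TA z Q1 S T = (states TA - divg TA) \<union> {q \<in> Q1. q \<in> states TA \<and>
    (1 \<le> snd q (FClk z) \<longrightarrow> (\<forall>a p. step TA q (Act a) p \<longrightarrow> p \<in> S)) \<and>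
    (snd q (FClk z) < 1 \<longrightarrow> (\<forall>a p. step TA q (Act a) p \<longrightarrow> p \<in> T))}"

definition au_step :: "('l, 'a, 'p) ta \<Rightarrow> nat \<Rightarrow> 'l state set \<Rightarrow> 'l state set \<Rightarrow> 'l state set \<Rightarrow> 'l state set \<Rightarrow>
    'l state set" where
  "au_step TA z Q1 Q2 S T = {q. \<exists>d. can_delay TA q d \<and>
    (dly q d \<in> Q2 \<or> dly q d \<in> time_stop TA \<and>
      (\<forall>e. can_delay TA q (d + e) \<and> 0 \<le> e \<longrightarrow> dly q (d + e) \<in> au_guard TA z Q1 S T)) \<and>
    (\<forall>u. 0 \<le> u \<and> u < d \<longrightarrow> dly q u \<in> au_guard TA z Q1 S T \<union> Q2)}"

lemma au_guard_divg: "q \<in> au_guard TA z Q1 S T \<Longrightarrow> q \<in> divg TA \<Longrightarrow> q \<in> Q1"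
  by (auto simp: au_guard_def)

lemma time_stop_dly:
  assumes "q \<in> time_stop TA" "can_delay TA q d"
  shows "dly q d \<in> time_stop TA"
  unfolding time_stop_def
proof (intro CollectI conjI allI impI)
  show "dly q d \<in> states TA" using can_delay_dly_states[OF assms(2), of d] can_delay_nonneg[OF assms(2)] by simp
  fix e assume "can_delay TA (dly q d) e"
  then have "can_delay TA q (d + e)" by (rule can_delay_add[OF assms(2)])
  then have "d + e < 1" using assms(1) unfolding time_stop_def by blast
  then show "e < 1" using can_delay_nonneg[OF assms(2)] by simp
qed

text \<open>A violation not met in the first transition passes to the tail. Hence no action may
  enter \<open>S\<close>, where the until is already guaranteed. With \<open>z\<close> at least
  \<open>1\<close> the guard sends every action into \<open>S\<close>, so only a delay
  remains.\<close>

lemma au_step_succ: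
  assumes T: "T \<subseteq> au_step TA z Q1 Q2 S T"
    and S: "\<And>st lb. irun TA st lb \<Longrightarrow> st 0 \<in> S \<Longrightarrow> upath st lb (Q1 \<union> Q2) Q2"
    and r: "irun TA st lb" and q: "st 0 \<in> au_step TA z Q1 Q2 S T" and n: "\<not> upath st lb (Q1 \<union> Q2) Q2"
  shows "st 1 \<in> au_step TA z Q1 Q2 S T"
    and "\<not> upath (\<lambda>i. st (Suc i)) (\<lambda>i. lb (Suc i)) (Q1 \<union> Q2) Q2"
    and "1 \<le> snd (st 0) (FClk z) \<Longrightarrow> \<exists>d. lb 0 = Delay d"
proof -
  let ?G = "au_guard TA z Q1 S T" and ?\<delta> = "lbl_delay (lb 0)"
  obtain d where d: "can_delay TA (st 0) d" and
    e: "dly (st 0) d \<in> Q2 \<or> dly (st 0) d \<in> time_stop TA \<and>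
      (\<forall>e. can_delay TA (st 0) (d + e) \<and> 0 \<le> e \<longrightarrow> dly (st 0) (d + e) \<in> ?G)" and
    u: "\<And>u. 0 \<le> u \<Longrightarrow> u < d \<Longrightarrow> dly (st 0) u \<in> ?G \<union> Q2"
    using q unfolding au_step_def by blast
  have s: "step TA (st 0) (lb 0) (st 1)" using irun_step[OF r, of 0] by simp
  have \<delta>: "0 \<le> ?\<delta>" "can_delay TA (st 0) ?\<delta>" using step_delay_nonneg[OF s] step_can_delay[OF s] .
  have GQ: "dly (st 0) v \<in> Q1 \<union> Q2" if "dly (st 0) v \<in> ?G \<union> Q2" "0 \<le> v" "v \<le> ?\<delta>" for v
    using that au_guard_divg irun_divg[OF r that(2,3)] by blast
  have nohead: "\<not> (0 \<le> t \<and> t \<le> ?\<delta> \<and> dly (st 0) t \<in> Q2 \<and> (\<forall>u. 0 \<le> u \<and> u < t \<longrightarrow> dly (st 0) u \<in> Q1 \<union> Q2))" for t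
    using n upath_unfold[of st lb "Q1 \<union> Q2" Q2] by blast
  \<comment> \<open>Were the state at \<open>d\<close> in \<open>Q2\<close>, the first transition
    would reach it and complete the until, so only the time-stop alternative is left.\<close>
  have stop: "dly (st 0) d \<in> time_stop TA \<and>
      (\<forall>e. can_delay TA (st 0) (d + e) \<and> 0 \<le> e \<longrightarrow> dly (st 0) (d + e) \<in> ?G)" if "d \<le> ?\<delta>"
  proof (rule ccontr)
    assume "\<not> ?thesis"
    then have "dly (st 0) d \<in> Q2" using e by blast
    moreover have "dly (st 0) v \<in> Q1 \<union> Q2" if "0 \<le> v" "v < d" for v
      using GQ[OF u[OF that] that(1)] that(2) \<open>d \<le> ?\<delta>\<close> by simp
    ultimately show False using nohead[of d] that can_delay_nonneg[OF d] by blast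
  qed
  have all: "dly (st 0) v \<in> ?G \<union> Q2" if v: "0 \<le> v" "v \<le> ?\<delta>" for v
  proof (cases "v < d")
    case True
    then show ?thesis using u v by blast
  next
    case False
    then have "can_delay TA (st 0) (d + (v - d)) \<and> 0 \<le> v - d" using can_delay_le[OF \<delta>(2) v] by simp
    moreover have "d \<le> ?\<delta>" using False v by simp
    ultimately have "dly (st 0) (d + (v - d)) \<in> ?G" using stop by blast
    then show ?thesis by simp
  qed
  show tl: "\<not> upath (\<lambda>i. st (Suc i)) (\<lambda>i. lb (Suc i)) (Q1 \<union> Q2) Q2"
    using n GQ[OF all] upath_unfold[of st lb "Q1 \<union> Q2" Q2] by blast
  have act: "st 0 \<in> ?G \<and> st 0 \<in> divg TA" if "lb 0 = Act a" for a
    using all[of 0] nohead[of 0] that irun_divg[OF r, of 0] by auto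
  show "\<exists>d. lb 0 = Delay d" if z: "1 \<le> snd (st 0) (FClk z)"
  proof (cases "lb 0")
    case (Act a)
    have "st 1 \<in> S" using act[OF Act] z s Act unfolding au_guard_def by auto
    then show ?thesis using S[OF irun_tl[OF r]] tl by simp
  qed auto
  show "st 1 \<in> au_step TA z Q1 Q2 S T"
  proof (cases "lb 0")
    case (Act a)
    have "\<not> 1 \<le> snd (st 0) (FClk z)"
    proof
      assume "1 \<le> snd (st 0) (FClk z)"
      then have "st 1 \<in> S" using act[OF Act] s Act unfolding au_guard_def by auto
      then show False using S[OF irun_tl[OF r]] tl by simp
    qed
    then have "st 1 \<in> T" using act[OF Act] s Act unfolding au_guard_def by auto
    then show ?thesis using T by blast
  next
    case (Delay x)
    then have x: "?\<delta> = x" "st 1 = dly (st 0) x" using s by (auto simp: step_Delay_iff)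
    have canx: "can_delay TA (st 0) x" using \<delta> x by simp
    have x0: "0 \<le> x" using \<delta> x by simp
    \<comment> \<open>If the delay ends no later than \<open>d\<close>, the remaining witness is
      \<open>d - x\<close>; otherwise the new state lies in the time-stop phase and delay
      \<open>0\<close> is a witness.\<close>
    show ?thesis
    proof (cases "x \<le> d")
      case True
      have "can_delay TA (st 1) (d - x)" using can_delay_dly[OF d x0 True] x by simp
      moreover have "dly (st 1) (d - x) \<in> Q2 \<or> dly (st 1) (d - x) \<in> time_stop TA \<and>
          (\<forall>e. can_delay TA (st 1) (d - x + e) \<and> 0 \<le> e \<longrightarrow> dly (st 1) (d - x + e) \<in> ?G)"
      proof -
        have "can_delay TA (st 0) (d + e)" if "can_delay TA (st 1) (d - x + e)" for e
          using can_delay_add[OF canx, of "d - x + e"] that x by simp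
        moreover have "dly (st 1) (d - x + e) = dly (st 0) (d + e)" for e using x by simp
        moreover have "dly (st 1) (d - x) = dly (st 0) d" using x by simp
        ultimately show ?thesis using e by simp blast
      qed
      moreover have "dly (st 1) v \<in> ?G \<union> Q2" if "0 \<le> v" "v < d - x" for v
        using u[of "x + v"] that x x0 by simp
      ultimately show ?thesis unfolding au_step_def by blast
    next
      case False
      then have "d \<le> ?\<delta>" using x by simp
      note st = stop[OF this]
      have "can_delay TA (dly (st 0) d) (x - d)"
        using can_delay_dly[OF canx can_delay_nonneg[OF d]] False by simp
      from time_stop_dly[OF _ this] have "st 1 \<in> time_stop TA" using st x by simp
      moreover have "dly (st 1) (0 + e) \<in> ?G" if "can_delay TA (st 1) (0 + e) \<and> 0 \<le> e" for e
      proof -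
        have "can_delay TA (st 0) (x + e)" using can_delay_add[OF canx, of e] that x by simp
        then have "can_delay TA (st 0) (d + (x - d + e)) \<and> 0 \<le> x - d + e" using False that by simp
        then have "dly (st 0) (d + (x - d + e)) \<in> ?G" using st by blast
        then show ?thesis using x by simp
      qed
      moreover have "can_delay TA (st 1) 0"
        using can_delay_dly_states[OF canx x0] x by simp
      ultimately show ?thesis unfolding au_step_def by (intro CollectI exI[of _ 0]) auto
    qed
  qed
qed

text \<open>Delays in a row are one long delay cut into pieces, unfolded here until
  \<open>d\<close>. Comparing \<open>Y\<close> with \<open>Q1\<close> on divergent states suffices,
  since all states on a run are divergent.\<close>

lemma upath_delays:
  assumes "irun TA st lb" "\<And>i. \<exists>d. lb i = Delay d" "0 \<le> d" "d \<le> (\<Sum>i<n. lbl_delay (lb i))"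
    "dly (st 0) d \<in> Q2" "\<And>u. 0 \<le> u \<Longrightarrow> u < d \<Longrightarrow> dly (st 0) u \<in> Y" "Y \<inter> divg TA \<subseteq> Q1"
  shows "upath st lb Q1 Q2"
  using assms
proof (induction n arbitrary: st lb d)
  case 0
  then have "d = 0" by simp
  then show ?case using 0 step_delay_nonneg[OF irun_step[OF 0(1), of 0]]
    by (subst upath_unfold) (auto intro!: exI[of _ "0::real"])
next
  case (Suc n)
  let ?\<delta> = "lbl_delay (lb 0)"
  have s: "step TA (st 0) (lb 0) (st 1)" using irun_step[OF Suc.prems(1), of 0] by simp
  have st1: "st (Suc 0) = dly (st 0) ?\<delta>"
    using s Suc.prems(2)[of 0] by (auto simp: step_Delay_iff)
  have Q1: "dly (st 0) u \<in> Q1" if "0 \<le> u" "u < d" "u \<le> ?\<delta>" for u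
    using Suc.prems(6)[OF that(1,2)] Suc.prems(7) irun_divg[OF Suc.prems(1) that(1,3)] by blast
  show ?case
  proof (cases "d \<le> ?\<delta>")
    case True
    then have "\<forall>u. 0 \<le> u \<and> u < d \<longrightarrow> dly (st 0) u \<in> Q1" using Q1 by simp
    then show ?thesis using True Suc.prems(3,5) by (subst upath_unfold) blast
  next
    case False
    have "upath (\<lambda>i. st (Suc i)) (\<lambda>i. lb (Suc i)) Q1 Q2"
    proof (rule Suc.IH[OF irun_tl[OF Suc.prems(1)], of "d - ?\<delta>"])
      show "d - ?\<delta> \<le> (\<Sum>i<n. lbl_delay (lb (Suc i)))"
        using Suc.prems(4) by (simp add: sum.lessThan_Suc_shift del: sum.lessThan_Suc)
      show "dly (st (Suc 0)) u \<in> Y" if "0 \<le> u" "u < d - ?\<delta>" for u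
        using Suc.prems(6)[of "?\<delta> + u"] that step_delay_nonneg[OF s] by (simp add: st1)
    qed (use False Suc.prems in \<open>auto simp: st1\<close>)
    then show ?thesis using Q1 False by (subst upath_unfold) auto
  qed
qed

lemma irun_shift: "irun TA st lb \<Longrightarrow> irun TA (\<lambda>i. st (n + i)) (\<lambda>i. lb (n + i))"
proof (induction n)
  case (Suc n)
  then show ?case using irun_tl[OF Suc.IH] by simp
qed simp

lemma irun_FClk:
  assumes "timed_automaton TA" "irun TA st lb"
  shows "snd (st n) (FClk z) = snd (st 0) (FClk z) + (\<Sum>i<n. lbl_delay (lb i))"
  by (induction n) (auto simp: step_FClk[OF assms(1) irun_step[OF assms(2)]])

text \<open>\<open>S\<close> stands for what the outer fixpoint already guarantees. Once
  \<open>z\<close> is at least \<open>1\<close>, a violating run consists of delays only; it then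
  reaches \<open>Q2\<close> or a time stop, and letting one more time unit pass is impossible from
  the latter.\<close>

lemma au_step_sound:
  assumes ta: "timed_automaton TA"
    and T: "T \<subseteq> au_step TA z Q1 Q2 S T"
    and S: "\<And>st lb. irun TA st lb \<Longrightarrow> st 0 \<in> S \<Longrightarrow> upath st lb (Q1 \<union> Q2) Q2"
    and r: "irun TA st lb" and q: "st 0 \<in> T"
  shows "upath st lb (Q1 \<union> Q2) Q2"
proof (rule ccontr)
  assume n: "\<not> upath st lb (Q1 \<union> Q2) Q2"
  have inv: "st i \<in> au_step TA z Q1 Q2 S T \<and>
      \<not> upath (\<lambda>j. st (i + j)) (\<lambda>j. lb (i + j)) (Q1 \<union> Q2) Q2" for i
  proof (induction i)
    case 0
    then show ?case using q T n by auto
  next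
    case (Suc i)
    then show ?case using au_step_succ(1,2)[OF T S irun_shift[OF r, of i]] by simp
  qed
  have del: "\<exists>d. lb i = Delay d" if "1 \<le> snd (st i) (FClk z)" for i
    using au_step_succ(3)[OF T S irun_shift[OF r, of i]] inv[of i] that by simp
  obtain N where "1 - snd (st 0) (FClk z) \<le> (\<Sum>i<N. lbl_delay (lb i))" using r unfolding irun_def by blast
  then have N: "1 \<le> snd (st N) (FClk z)" using irun_FClk[OF ta r, of N z] by simp
  let ?st = "\<lambda>i. st (N + i)" and ?lb = "\<lambda>i. lb (N + i)"
  have r': "irun TA ?st ?lb" by (rule irun_shift[OF r])
  have delays: "\<exists>d. ?lb i = Delay d" for i
  proof (rule del)
    have "0 \<le> (\<Sum>i<i. lbl_delay (?lb i))"
      by (rule sum_nonneg) (rule step_delay_nonneg[OF irun_step[OF r']])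
    then show "1 \<le> snd (?st i) (FClk z)" using irun_FClk[OF ta r', of i z] N by simp
  qed
  let ?G = "au_guard TA z Q1 S T"
  obtain d where d: "can_delay TA (?st 0) d" and
    e: "dly (?st 0) d \<in> Q2 \<or> dly (?st 0) d \<in> time_stop TA" and
    u: "\<And>u. 0 \<le> u \<Longrightarrow> u < d \<Longrightarrow> dly (?st 0) u \<in> ?G \<union> Q2"
    using inv[of N] unfolding au_step_def by auto
  have "dly (?st 0) d \<notin> Q2"
  proof
    assume Q2: "dly (?st 0) d \<in> Q2"
    obtain m where "d \<le> (\<Sum>i<m. lbl_delay (?lb i))" using r' unfolding irun_def by blast
    moreover have "(?G \<union> Q2) \<inter> divg TA \<subseteq> Q1 \<union> Q2" using au_guard_divg by blast
    ultimately have "upath ?st ?lb (Q1 \<union> Q2) Q2"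
      using upath_delays[OF r' delays can_delay_nonneg[OF d] _ Q2 u] by blast
    then show False using inv by blast
  qed
  then have stop: "dly (?st 0) d \<in> time_stop TA" using e by blast
  have all: "can_delay TA (?st 0) (\<Sum>i<m. lbl_delay (?lb i)) \<and> ?st m = dly (?st 0) (\<Sum>i<m. lbl_delay (?lb i))" for m
  proof (induction m)
    case 0
    then show ?case using can_delay_states[OF d] by simp
  next
    case (Suc m)
    obtain x where x: "?lb m = Delay x" using delays by blast
    then have "can_delay TA (?st m) x" "?st (Suc m) = dly (?st m) x"
      using irun_step[OF r', of m] by (auto simp: step_Delay_iff)
    then show ?case using Suc x can_delay_add[of TA "?st 0" "\<Sum>i<m. lbl_delay (?lb i)" x] by simp
  qed
  \<comment> \<open>One time unit beyond \<open>d\<close>, which the time stop at \<open>d\<close>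
    forbids.\<close>
  obtain m where m: "d + 1 \<le> (\<Sum>i<m. lbl_delay (?lb i))" using r' unfolding irun_def by blast
  then have "can_delay TA (?st 0) (d + 1)"
    using can_delay_le[OF conjunct1[OF all[of m]] _ m] can_delay_nonneg[OF d] by simp
  then have "can_delay TA (dly (?st 0) d) 1"
    using can_delay_dly[of TA "?st 0" "d + 1" d] can_delay_nonneg[OF d] by simp
  then show False using stop unfolding time_stop_def by auto
qed

text \<open>\<open>T\<close> is the candidate for the inner greatest fixpoint. Excluding paths that
  avoid \<open>Q2\<close>, bring \<open>z\<close> to \<open>1\<close> and end outside
  \<open>S\<close> is what forces actions into \<open>S\<close> once \<open>z\<close> is at least
  \<open>1\<close>.\<close>

lemma au_step_complete:
  fixes TA :: "('l, 'a, 'p) ta" and \<phi>1 \<phi>2 :: "'p tctl" and S :: "'l state set" and z :: nat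
  assumes ta: "timed_automaton TA"
  defines "Q1 \<equiv> tctl_sem TA \<phi>1" and "Q2 \<equiv> tctl_sem TA \<phi>2"
  defines "T \<equiv> {s \<in> states TA. s \<notin> bad TA (Q1 \<union> Q2) Q2 \<and>
    \<not> (\<exists>n D p. path TA (- Q2) n s D p \<and> 1 \<le> snd s (FClk z) + D \<and> p \<in> states TA - S)}"
  shows "T \<subseteq> au_step TA z Q1 Q2 S T"
proof
  fix s assume sT: "s \<in> T"
  let ?G = "au_guard TA z Q1 S T"
  have s: "s \<in> states TA" "s \<notin> bad TA (Q1 \<union> Q2) Q2" using sT by (auto simp: T_def)
  have nopath: False if "path TA (- Q2) n s D p" "1 \<le> snd s (FClk z) + D" "p \<in> states TA" "p \<notin> S" for n D p
    using sT that unfolding T_def by blast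
  \<comment> \<open>If the guard fails, the delayed state is divergent. Outside \<open>Q1\<close> it
    would be bad at once; otherwise an action leads outside \<open>T\<close>, or outside
    \<open>S\<close> with \<open>z\<close> at least \<open>1\<close>. The obstacle found there, with
    delay and action prepended, contradicts \<open>s \<in> T\<close>.\<close>
  have G: "dly s d \<in> ?G" if d: "can_delay TA s d" and av: "\<And>u. 0 \<le> u \<Longrightarrow> u \<le> d \<Longrightarrow> dly s u \<notin> Q2" for d
  proof (rule ccontr)
    assume nG: "dly s d \<notin> ?G"
    have d0: "0 \<le> d" by (rule can_delay_nonneg[OF d])
    have sd: "step TA s (Delay d) (dly s d)" using d by (simp add: step_Delay_iff)
    have xs: "dly s d \<in> states TA" using can_delay_dly_states[OF d d0] by simp
    have bs: "dly s d \<notin> bad TA (Q1 \<union> Q2) Q2"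
      using bad_step[OF sd, of "Q1 \<union> Q2" Q2] s(2) av by auto
    have xd: "dly s d \<in> divg TA" using nG xs by (auto simp: au_guard_def)
    have "dly s d \<in> Q1" using bad_blocked[OF xd, of "Q1 \<union> Q2" Q2] bs av[of d] d0 by auto
    then obtain a p where p: "step TA (dly s d) (Act a) p"
        "1 \<le> snd (dly s d) (FClk z) \<and> p \<notin> S \<or> p \<notin> T"
      using nG xs unfolding au_guard_def by blast
    have ps: "p \<in> states TA" by (rule step_target_states[OF ta p(1)])
    have ext: "path TA (- Q2) (Suc (Suc n)) s (d + D) p'" if "path TA (- Q2) n p D p'" for n D p'
    proof -
      have "path TA (- Q2) (Suc n) (dly s d) (lbl_delay (Act a :: 'a lbl) + D) p'"
        by (rule path_step[OF p(1) _ that]) (use av[of d] d0 in auto)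
      from path_step[OF sd _ this] show ?thesis using av by auto
    qed
    have zp: "snd p (FClk z) = snd s (FClk z) + d" using step_FClk[OF ta p(1), of z] by simp
    have "\<not> (1 \<le> snd (dly s d) (FClk z) \<and> p \<notin> S)"
      using nopath[OF ext[OF path_nil] _ ps] by auto
    then have "p \<notin> T" using p(2) by blast
    then consider "p \<in> bad TA (Q1 \<union> Q2) Q2" |
      n D p' where "path TA (- Q2) n p D p'" "1 \<le> snd p (FClk z) + D" "p' \<in> states TA" "p' \<notin> S"
      using ps unfolding T_def by blast
    then show False
    proof cases
      case 1
      then show False using bad_step[OF p(1) 1] bs av[of d] d0 by auto
    next
      case 2
      then show False using nopath[OF ext[OF 2(1)] _ 2(3,4)] zp by simp
    qed
  qed
  show "s \<in> au_step TA z Q1 Q2 S T"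
  proof (cases "\<exists>d. can_delay TA s d \<and> dly s d \<in> Q2")
    case True
    define P where "P = {d. can_delay TA s d \<and> dly s d \<in> Q2}"
    define e where "e = Inf P"
    have ne: "P \<noteq> {}" using True by (auto simp: P_def)
    have P0: "0 \<le> d" if "d \<in> P" for d using that can_delay_nonneg[of TA s d] by (auto simp: P_def)
    then have bdd: "bdd_below P" by (meson bdd_belowI)
    have e0: "0 \<le> e" unfolding e_def by (rule cInf_greatest[OF ne P0])
    have le: "e \<le> d" if "d \<in> P" for d unfolding e_def by (rule cInf_lower[OF that bdd])
    obtain d0 where d0: "d0 \<in> P" using ne by blast
    have can: "can_delay TA s u" if "0 \<le> u" "u \<le> d" "d \<in> P" for u d
      using can_delay_le[of TA s d u] that by (auto simp: P_def)
    have before: "dly s u \<notin> Q2" if "0 \<le> u" "u < e" for u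
      using le[of u] can[OF that(1) _ d0] le[OF d0] that by (auto simp: P_def)
    show ?thesis
    proof (cases "dly s e \<in> Q2")
      case True
      have "dly s u \<in> ?G \<union> Q2" if "0 \<le> u" "u < e" for u
        using G[OF can[OF that(1) _ d0]] before le[OF d0] that by auto
      then show ?thesis unfolding au_step_def using True can[OF e0 le[OF d0] d0] by blast
    next
      case False
      \<comment> \<open>The infimum is not attained: right after it \<open>\<phi>2\<close> holds throughout, with no gaps from
        which an action could lead outside \<open>T\<close>.\<close>
      obtain \<epsilon> where \<epsilon>: "\<epsilon> > 0" "\<And>d1 d2. e < d1 \<Longrightarrow> d1 < e + \<epsilon> \<Longrightarrow> e < d2 \<Longrightarrow> d2 < e + \<epsilon> \<Longrightarrow>
          dly s d1 \<in> states TA \<Longrightarrow> dly s d2 \<in> states TA \<Longrightarrow> dly s d1 \<in> Q2 \<Longrightarrow> dly s d2 \<in> Q2"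
        using tctl_right_constant[OF ta, of e s \<phi>2] unfolding Q2_def by blast
      obtain d where d: "d \<in> P" "d < e + \<epsilon>"
        using cInf_lessD[OF ne, of "e + \<epsilon>"] \<epsilon>(1) by (auto simp: e_def)
      have ed: "e < d" using le[OF d(1)] False d(1) by (cases "d = e") (auto simp: P_def)
      have dS: "dly s u \<in> states TA" if "0 \<le> u" "u \<le> d" for u
        using can_delay_dly_states[of TA s d u] d(1) that by (auto simp: P_def)
      have "dly s u \<in> ?G \<union> Q2" if "0 \<le> u" "u < d" for u
      proof (cases "u \<le> e")
        case True
        have "dly s v \<notin> Q2" if "0 \<le> v" "v \<le> u" for v
          using before[of v] False True that by (cases "v = e") auto
        then show ?thesis using G[OF can[OF that(1) _ d(1)]] that by auto
      next
        case False
        then have "dly s u \<in> Q2"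
          using \<epsilon>(2)[of d u] d ed dS[of u] dS[of d] that P0[OF d(1)] by (auto simp: P_def)
        then show ?thesis by blast
      qed
      then show ?thesis unfolding au_step_def using d(1) unfolding P_def by blast
    qed
  next
    case False
    then have no: "dly s d \<notin> Q2" if "can_delay TA s d" for d using that by blast
    have allG: "dly s d \<in> ?G" if "can_delay TA s d" for d
      using G[OF that] no can_delay_le[OF that] by blast
    \<comment> \<open>If time could pass forever, unit delays would form a run that avoids
      \<open>Q2\<close> altogether, making \<open>s\<close> bad.\<close>
    have "\<not> (\<forall>n::nat. can_delay TA s (real n))"
    proof
      assume all: "\<forall>n::nat. can_delay TA s (real n)"
      define lb :: "nat \<Rightarrow> 'a lbl" where "lb = (\<lambda>_. Delay 1)"
      have can: "can_delay TA (dly s (real i)) u" if "0 \<le> u" "u \<le> 1" for i u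
        using can_delay_le[OF can_delay_dly[of TA s "real (Suc i)" "real i"], of u] all[rule_format, of "Suc i"] that
        by simp
      have "irun TA (\<lambda>i. dly s (real i)) lb"
        unfolding irun_def lb_def using can[of 1] real_arch_simple
        by (auto simp: step_Delay_iff add.commute)
      moreover have "dly (dly s (real i)) u \<notin> Q2" if "0 \<le> u" "u \<le> lbl_delay (lb i)" for i u
        using no[OF can_delay_add[OF all[rule_format, of i] can[OF that(1)]]] that by (simp add: lb_def)
      ultimately have "dly s (real 0) \<in> bad TA (Q1 \<union> Q2) Q2" by (rule bad_avoid)
      then show False using s(2) by simp
    qed
    then obtain n :: nat where n: "\<not> can_delay TA s (real n)" "\<And>m. m < n \<Longrightarrow> can_delay TA s (real m)"
      using exists_least_iff[of "\<lambda>n. \<not> can_delay TA s (real n)"] by blast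
    \<comment> \<open>Here \<open>n\<close> is the least impossible integral delay: after
      \<open>n - 1\<close> one more time unit cannot pass, so a time stop is reached there.\<close>
    have "n \<noteq> 0" using n(1) s(1) by (cases n) auto
    then obtain m where m: "n = Suc m" by (cases n) auto
    have cm: "can_delay TA s (real m)" using n(2) m by simp
    have "dly s (real m) \<in> time_stop TA"
      unfolding time_stop_def
    proof (intro CollectI conjI allI impI)
      show "dly s (real m) \<in> states TA" using can_delay_dly_states[OF cm, of "real m"] by simp
      fix e assume e: "can_delay TA (dly s (real m)) e"
      show "e < 1"
      proof (rule ccontr)
        assume "\<not> e < 1"
        then have "can_delay TA s (real n)"
          using can_delay_add[OF cm can_delay_le[OF e, of 1]] m by (simp add: add.commute)
        then show False using n(1) by blast
      qed
    qed
    moreover have "dly s u \<in> ?G \<union> Q2" if "0 \<le> u" "u < real m" for u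
      using allG[OF can_delay_le[OF cm that(1)]] that by simp
    ultimately show ?thesis unfolding au_step_def using cm allG by blast
  qed
qed

text \<open>A state of \<open>?U\<close> outside a pre-fixed point \<open>S\<close> would start an
  endless chain of paths avoiding \<open>Q2\<close>; conversely \<open>?U\<close> is itself a
  pre-fixed point, by \<open>au_step_sound\<close>. As \<open>z\<close> is fresh, the reset at each
  unfolding does not affect membership in \<open>?U\<close>.\<close>

lemma au_fixpoint:
  fixes TA :: "('l, 'a, 'p) ta" and \<phi>1 \<phi>2 :: "'p tctl" and z :: nat
  assumes ta: "timed_automaton TA" and z: "FClk z \<notin> tctl_clocks \<phi>1 \<union> tctl_clocks \<phi>2"
  defines "Q1 \<equiv> tctl_sem TA \<phi>1" and "Q2 \<equiv> tctl_sem TA \<phi>2"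
  shows "tctl_sem TA (AU \<phi>1 \<phi>2) = \<Inter>{S. S \<subseteq> states TA \<and>
    {q \<in> states TA. state_reset q z \<in> \<Union>{T. T \<subseteq> states TA \<and> T \<subseteq> au_step TA z Q1 Q2 S T}} \<subseteq> S}"
    (is "?U = \<Inter>{S. _ \<and> ?F S \<subseteq> S}")
proof (intro equalityI subsetI)
  have zU: "FClk z \<notin> tctl_clocks (AU \<phi>1 \<phi>2)" using z by simp
  have U: "?U = states TA - bad TA (Q1 \<union> Q2) Q2" unfolding tctl_sem_AU_bad Q1_def Q2_def ..
  have fresh: "p \<in> ?U \<longleftrightarrow> p' \<in> ?U"
    if "state_reset p z = state_reset p' z" "p \<in> states TA" "p' \<in> states TA" for p p'
    by (rule tctl_fresh[OF ta zU that])
  {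
    fix q assume q: "q \<in> ?U"
    show "q \<in> \<Inter>{S. S \<subseteq> states TA \<and> ?F S \<subseteq> S}"
    proof (intro InterI, elim CollectE conjE, rule ccontr)
      fix S assume S: "S \<subseteq> states TA" "?F S \<subseteq> S" and nq: "q \<notin> S"
      define X where "X = ?U - ?F S"
      have "\<exists>n D p. 1 \<le> D \<and> path TA (- Q2) n q D p \<and> p \<in> X" if qX: "q \<in> X" for q
      proof -
        define T where "T = {s \<in> states TA. s \<notin> bad TA (Q1 \<union> Q2) Q2 \<and>
          \<not> (\<exists>n D p. path TA (- Q2) n s D p \<and> 1 \<le> snd s (FClk z) + D \<and> p \<in> states TA - S)}"
        have T: "T \<subseteq> au_step TA z Q1 Q2 S T" "T \<subseteq> states TA"
          unfolding T_def Q1_def Q2_def by (rule au_step_complete[OF ta]) blast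
        have qU: "q \<in> ?U" "q \<in> states TA" "q \<notin> ?F S" using qX U unfolding X_def by blast+
        let ?q = "state_reset q z"
        have q0: "?q \<in> states TA" by (rule state_reset_states[OF ta qU(2)])
        \<comment> \<open>As \<open>T\<close> is a post-fixed point, \<open>?q \<in> T\<close> would
          put \<open>q\<close> into \<open>?F S\<close>.\<close>
        have "?q \<notin> T" using qU(2,3) T by blast
        moreover have "?q \<in> ?U" using fresh[of ?q q] qU q0 by simp
        ultimately obtain n D p where p: "path TA (- Q2) n ?q D p" "1 \<le> snd ?q (FClk z) + D"
            "p \<in> states TA" "p \<notin> S"
          using q0 U unfolding T_def by blast
        have D: "1 \<le> D" using p(2) by (simp add: state_reset_eq)
        have "q' \<in> - Q2" if "state_reset q z = state_reset q' z" "q \<in> states TA" "q' \<in> states TA"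
            "q \<in> - Q2" for q q'
          using tctl_fresh[OF ta _ that(1-3), of \<phi>2] z that(4) unfolding Q2_def by blast
        \<comment> \<open>The path starts at the reset state. Changing only \<open>z\<close> moves
          it to \<open>q\<close>, and its end also changes only in \<open>z\<close>, on which
          neither \<open>?F S\<close> nor \<open>?U\<close> depends.\<close>
        then obtain p' where p': "path TA (- Q2) n q D p'" "state_reset p z = state_reset p' z" "p' \<in> states TA"
          using path_fresh[OF ta _ p(1), of z q] qU(2) by (metis state_reset_idem)
        have "p \<notin> ?F S" using p(4) S(2) by blast
        then have "p' \<notin> ?F S" using p'(2) p(3) by simp
        moreover have "p' \<in> ?U"
          using bad_path[OF p'(1), of Q2 "Q1 \<union> Q2"] qU(1) p'(3) unfolding U by blast
        ultimately show ?thesis using D p'(1) unfolding X_def by blast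
      qed
      moreover have "q \<in> X" using q nq S(2) unfolding X_def by blast
      ultimately obtain st and lb :: "nat \<Rightarrow> 'a lbl" where r: "irun TA st lb" "st 0 = q"
          "\<And>i u. 0 \<le> u \<Longrightarrow> u \<le> lbl_delay (lb i) \<Longrightarrow> dly (st i) u \<in> - Q2"
        using irun_of_paths[of X TA "- Q2" q] by blast
      have "st 0 \<in> bad TA (Q1 \<union> Q2) Q2" by (rule bad_avoid[OF r(1)]) (use r(3) in blast)
      then show False using q r(2) U by blast
    qed
  }
  have "?F ?U \<subseteq> ?U"
  proof
    fix q assume "q \<in> ?F ?U"
    then obtain T where T: "T \<subseteq> states TA" "T \<subseteq> au_step TA z Q1 Q2 ?U T" "state_reset q z \<in> T"
      and q: "q \<in> states TA" by blast
    have "upath st lb (Q1 \<union> Q2) Q2" if "irun TA st lb" "st 0 \<in> ?U" for st and lb :: "nat \<Rightarrow> 'a lbl"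
      using that unfolding tctl_sem_AU Q1_def Q2_def by blast
    from au_step_sound[OF ta T(2) this]
    have "upath st lb (Q1 \<union> Q2) Q2" if "irun TA st lb" "st 0 \<in> T" for st and lb :: "nat \<Rightarrow> 'a lbl"
      using that by blast
    then have "state_reset q z \<in> ?U"
      using T(1,3) unfolding tctl_sem_AU Q1_def Q2_def by auto
    then show "q \<in> ?U" using fresh[of "state_reset q z" q] q state_reset_states[OF ta q] by simp
  qed
  then show "q \<in> ?U" if "q \<in> \<Inter>{S. S \<subseteq> states TA \<and> ?F S \<subseteq> S}" for q
    using that tctl_sem_states[of TA "AU \<phi>1 \<phi>2"] by blast
qed

text \<open>The environment is arbitrary in the induction because translated subformulas are
  evaluated below fixpoint binders, where it has been updated.\<close>

lemma lrel_env_sem_emb: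
  fixes TA :: "('l, 'a, 'p) ta"
  assumes ta: "timed_automaton TA"
  shows "lrel_env_sem TA \<theta> (emb \<phi>) = tctl_sem TA \<phi>"
proof (induction \<phi> arbitrary: \<theta>)
  case (EU \<phi>1 \<phi>2)
  let ?Q1 = "tctl_sem TA \<phi>1" and ?Q2 = "tctl_sem TA \<phi>2"
  have "lrel_env_sem TA (\<theta>(0 := S)) (Ex (emb \<phi>1) (Or (And (emb \<phi>2) TDIV) (And (emb \<phi>1) (Dia UNIV (Var 0))))) =
    eu_step TA ?Q1 ?Q2 S" for S
  proof -
    have 1: "lrel_env_sem TA (\<theta>(0 := S)) (And (emb \<phi>2) TDIV) = ?Q2 \<inter> divg TA"
      by (subst lrel_env_sem_And) (simp_all add: EU.IH lrel_env_sem_TDIV[OF ta] tctl_sem_states)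
    have "lrel_env_sem TA (\<theta>(0 := S)) (Dia UNIV (Var 0)) = {q. \<exists>a p. step TA q (Act a) p \<and> p \<in> S}"
      using step_states[of TA] by auto
    then have 2: "lrel_env_sem TA (\<theta>(0 := S)) (And (emb \<phi>1) (Dia UNIV (Var 0))) =
        ?Q1 \<inter> {q. \<exists>a p. step TA q (Act a) p \<and> p \<in> S}"
      by (subst lrel_env_sem_And) (simp_all only: EU.IH tctl_sem_states)
    show ?thesis unfolding lrel_env_sem_Ex lrel_env_sem.simps(4) 1 2 EU.IH eu_step_def Let_def ..
  qed
  then show ?case unfolding tctl_sem_EU eu_fixpoint emb.simps lrel_env_sem.simps(8) by simp
next
  case (AU \<phi>1 \<phi>2)
  let ?Q1 = "tctl_sem TA \<phi>1" and ?Q2 = "tctl_sem TA \<phi>2"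
  let ?z = "fresh_fclock \<phi>1 \<phi>2"
  let ?\<gamma> = "Imp TDIV (And (emb \<phi>1) (And (Imp (cmp_atom (FClk ?z) Ge 1) (Box UNIV (Var 0)))
    (Imp (cmp_atom (FClk ?z) Lt 1) (Box UNIV (Var 1)))))"
  have "lrel_env_sem TA (\<theta>(0 := S, 1 := T)) (au ?\<gamma> (emb \<phi>2)) = au_step TA ?z ?Q1 ?Q2 S T" for S T
  proof -
    let ?\<eta> = "\<theta>(0 := S, 1 := T)"
    have 1: "lrel_env_sem TA ?\<eta> (Imp (cmp_atom (FClk ?z) Ge 1) (Box UNIV (Var 0))) =
      {q \<in> states TA. 1 \<le> snd q (FClk ?z) \<longrightarrow> (\<forall>a p. step TA q (Act a) p \<longrightarrow> p \<in> S)}"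
      unfolding lrel_env_sem_Imp lrel_env_sem_Box[OF ta] lrel_env_sem_cmp_atom by auto
    have 2: "lrel_env_sem TA ?\<eta> (Imp (cmp_atom (FClk ?z) Lt 1) (Box UNIV (Var 1))) =
      {q \<in> states TA. snd q (FClk ?z) < 1 \<longrightarrow> (\<forall>a p. step TA q (Act a) p \<longrightarrow> p \<in> T)}"
      unfolding lrel_env_sem_Imp lrel_env_sem_Box[OF ta] lrel_env_sem_cmp_atom by auto
    have 3: "lrel_env_sem TA ?\<eta> (And (Imp (cmp_atom (FClk ?z) Ge 1) (Box UNIV (Var 0)))
        (Imp (cmp_atom (FClk ?z) Lt 1) (Box UNIV (Var 1)))) = {q \<in> states TA.
      (1 \<le> snd q (FClk ?z) \<longrightarrow> (\<forall>a p. step TA q (Act a) p \<longrightarrow> p \<in> S)) \<and>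
      (snd q (FClk ?z) < 1 \<longrightarrow> (\<forall>a p. step TA q (Act a) p \<longrightarrow> p \<in> T))}"
      by (subst lrel_env_sem_And) (unfold 1 2, blast+)
    have "lrel_env_sem TA ?\<eta> ?\<gamma> = au_guard TA ?z ?Q1 S T"
      unfolding lrel_env_sem_Imp lrel_env_sem_TDIV[OF ta] au_guard_def
      by (subst lrel_env_sem_And) (simp_all only: 3 AU.IH tctl_sem_states Int_def mem_Collect_eq)
    from lrel_env_sem_au[OF ta this AU.IH(2)] show ?thesis unfolding au_step_def .
  qed
  then show ?case
    unfolding au_fixpoint[OF ta fresh_fclock] emb.simps Let_def lrel_env_sem.simps(7,8) lrel_env_sem_Nu
    by simp
qed simp_all

theorem theorem2:
  fixes TA :: "('l, 'a, 'p) ta" and \<phi> :: "'p tctl"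
  assumes "timed_automaton TA"
  shows "tctl_sem TA \<phi> = lrel_sem TA (emb \<phi>)"
  unfolding lrel_sem_def lrel_env_sem_emb[OF assms] ..

end
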